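(* Let $(X,\sigma)$ be a real non-degenerate symplectic vector space (of arbitrary, possibly infinite, dimension). Let $\mathcal{W}_0(X,\sigma)$ be the $*$-algebra generated by the Weyl elements $\{W(f)\mid f\in X\}$, and let $\mathcal{W}(X,\sigma)$ be its C*-closure, the Weyl algebra. Then the $*$-algebra $\mathcal{W}_0(X,\sigma)$ is algebraically amenable. In particular, the Weyl algebra $\mathcal{W}(X,\sigma)$ is a F\o lner C*-algebra.
   Context: **Weyl algebra.** For a non-degenerate symplectic vector space $(X,\sigma)$ the Weyl algebra $\mathcal{W}(X,\sigma)$ is defined abstractly as the C*-algebra generated by unitary elements $W(f)$, $f\in X$ (the Weyl elements), satisfying $W(f)^*=W(-f)$ and $$W(f)W(g)=e^{-\frac{i}{2}\sigma(f,g)}\,W(f+g),\qquad f,g\in X.$$ $\mathcal{W}_0(X,\sigma)\subset \mathcal{W}(X,\sigma)$ denotes the dense $*$-subalgebra generated by the Weyl elements; the Weyl elements form a linear basis of $\mathcal{W}_0(X,\sigma)$. The algebra $\mathcal{W}(X,\sigma)$ is unital and simple, and in general non-separable. **Algebraic amenability.** A $*$-subalgebra $\mathfrak{A}$ of a C*-algebra is *algebraically amenable* if there is a net $\{V_n\}_n$ of nonzero finite-dimensional linear subspaces of $\mathfrak{A}$ satisfying $$\lim_n \frac{\dim(AV_n+V_n)}{\dim(V_n)}=1\quad\text{for every } A\in\mathfrak{A}.$$ **F\o lner C*-algebra.** A C*-algebra $\mathcal{A}$ is a *F\o lner C*-algebra* if there exists a net of contractive completely positive (c.c.p.) maps $\varphi_n\colon\mathcal{A}\to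 M_{k(n)}(\mathbb{C})$ such that (i) $\lim_n \|\varphi_n(AB)-\varphi_n(A)\varphi_n(B)\|_{2,\mathrm{tr}}=0$ for every $A,B\in\mathcal{A}$, where $\|F\|_{2,\mathrm{tr}}:=\sqrt{\mathrm{tr}(F^*F)}$ for a matrix $F$ and $\mathrm{tr}$ is the unique tracial state on the matrix algebra (the normalized trace); (ii) $\|A\|=\lim_n\|\varphi_n(A)\|$ for every $A\in\mathcal{A}$ (operator norm on matrices). *)

theory Defs
  imports "HOL-Analysis.Analysis" "Jordan_Normal_Form.Schur_Decomposition"
begin

section \<open>Unital C*-algebras\<close>

class cstar_algebra = real_normed_algebra_1 + banach +
  fixes scaleC :: "complex \<Rightarrow> 'a \<Rightarrow> 'a"  (infixr \<open>*\<^sub>C\<close> 75)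
    and star :: "'a \<Rightarrow> 'a"
  assumes scaleC_add_right: "c *\<^sub>C (x + y) = c *\<^sub>C x + c *\<^sub>C y"
    and scaleC_add_left: "(c + d) *\<^sub>C x = c *\<^sub>C x + d *\<^sub>C x"
    and scaleC_scaleC: "c *\<^sub>C d *\<^sub>C x = (c * d) *\<^sub>C x"
    and scaleC_one: "1 *\<^sub>C x = x"
    and scaleR_scaleC: "r *\<^sub>R x = complex_of_real r *\<^sub>C x"
    and mult_scaleC_left: "(c *\<^sub>C x) * y = c *\<^sub>C (x * y)"
    and mult_scaleC_right: "x * (c *\<^sub>C y) = c *\<^sub>C (x * y)"
    and norm_scaleC: "norm (c *\<^sub>C x) = cmod c * norm x"
    and star_star: "star (star x) = x"
    and star_add: "star (x + y) = star x + star y"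
    and star_scaleC: "star (c *\<^sub>C x) = cnj c *\<^sub>C star x"
    and star_mult: "star (x * y) = star y * star x"
    and cstar_identity: "norm (star x * x) = (norm x)\<^sup>2"

global_interpretation complex_vector: vector_space "scaleC :: complex \<Rightarrow> 'a \<Rightarrow> 'a::cstar_algebra"
  defines csubspace = complex_vector.subspace
    and cspan = complex_vector.span
    and cdim = complex_vector.dim
  by unfold_locales (auto simp: scaleC_add_right scaleC_add_left scaleC_scaleC scaleC_one)

definition star_subalgebra :: "'a::cstar_algebra set \<Rightarrow> bool" where
  "star_subalgebra S \<longleftrightarrow> csubspace S \<and> (\<forall>x\<in>S. \<forall>y\<in>S. x * y \<in> S) \<and> (\<forall>x\<in>S. star x \<in> S)"

definition cstar_subalgebra :: "'a::cstar_algebra set \<Rightarrow> bool" where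
  "cstar_subalgebra S \<longleftrightarrow> star_subalgebra S \<and> closed S"

lemma star_subalgebra_hull: "star_subalgebra (star_subalgebra hull S)"
  by (rule hull_in) (auto simp: star_subalgebra_def complex_vector.subspace_def)

lemma cstar_subalgebra_closure:
  fixes S :: "'a::cstar_algebra set"
  assumes "star_subalgebra S"
  shows "cstar_subalgebra (closure S)"
proof -
  have star_norm: "norm (star x) = norm x" for x :: 'a
  proof -
    have "norm x \<le> norm (star x)" for x :: 'a
    proof (cases "x = 0")
      case False
      have "norm x * norm x \<le> norm (star x) * norm x"
        using norm_mult_ineq[of "star x" x] by (simp add: cstar_identity power2_eq_square)
      then show ?thesis using False by simp
    qed simp
    from this[of x] this[of "star x"] show ?thesis by (simp add: star_star)
  qed
  have star_diff: "star (x - y) = star x - star y" for x y :: 'a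
    using star_add[of "x - y" y] by (simp add: algebra_simps)
  have star_lim: "(\<lambda>n. star (f n)) \<longlonglongrightarrow> star x" if "f \<longlonglongrightarrow> x" for f :: "nat \<Rightarrow> 'a" and x
    using that unfolding LIMSEQ_iff star_diff[symmetric] star_norm .
  have scale_lim: "(\<lambda>n. c *\<^sub>C f n) \<longlonglongrightarrow> c *\<^sub>C x" if "f \<longlonglongrightarrow> x" for f :: "nat \<Rightarrow> 'a" and x c
  proof -
    have "(\<lambda>n. (c *\<^sub>C 1) * f n) \<longlonglongrightarrow> (c *\<^sub>C 1) * x" using that by (intro tendsto_intros)
    then show ?thesis by (simp add: mult_scaleC_left)
  qed
  have S: "0 \<in> S" "\<And>x y. x \<in> S \<Longrightarrow> y \<in> S \<Longrightarrow> x + y \<in> S" "\<And>c x. x \<in> S \<Longrightarrow> c *\<^sub>C x \<in> S"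
    "\<And>x y. x \<in> S \<Longrightarrow> y \<in> S \<Longrightarrow> x * y \<in> S" "\<And>x. x \<in> S \<Longrightarrow> star x \<in> S"
    using assms by (auto simp: star_subalgebra_def complex_vector.subspace_def)
  have "x + y \<in> closure S" "x * y \<in> closure S" if xy: "x \<in> closure S" "y \<in> closure S" for x y
  proof -
    obtain f g where fg: "\<And>n. f n \<in> S" "f \<longlonglongrightarrow> x" "\<And>n. g n \<in> S" "g \<longlonglongrightarrow> y"
      using xy by (auto simp: closure_sequential)
    show "x + y \<in> closure S" unfolding closure_sequential
      by (rule exI[of _ "\<lambda>n. f n + g n"]) (simp add: fg S tendsto_add)
    show "x * y \<in> closure S" unfolding closure_sequential
      by (rule exI[of _ "\<lambda>n. f n * g n"]) (simp add: fg S tendsto_mult)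
  qed
  moreover have "star x \<in> closure S" "c *\<^sub>C x \<in> closure S" if x: "x \<in> closure S" for x c
  proof -
    obtain f where f: "\<And>n. f n \<in> S" "f \<longlonglongrightarrow> x"
      using x by (auto simp: closure_sequential)
    show "star x \<in> closure S" unfolding closure_sequential
      by (rule exI[of _ "\<lambda>n. star (f n)"]) (simp add: f S star_lim)
    show "c *\<^sub>C x \<in> closure S" unfolding closure_sequential
      by (rule exI[of _ "\<lambda>n. c *\<^sub>C f n"]) (simp add: f S scale_lim)
  qed
  moreover have "0 \<in> closure S" using S(1) closure_subset by blast
  ultimately show ?thesis
    by (simp add: cstar_subalgebra_def star_subalgebra_def complex_vector.subspace_def)
qed

definition unitary_element :: "'a::cstar_algebra \<Rightarrow> bool" where
  "unitary_element u \<longleftrightarrow> star u * u = 1 \<and> u * star u = 1"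

section \<open>Nets\<close>

text \<open>
  Nets of objects are rendered below as proper filters on the type of these objects. This loses
  nothing: the two lemmas of this section show that the proper filters concentrated on \<open>P\<close> are
  exactly the filters generated by the tails of a net in \<open>P\<close>, with an arbitrary directed index
  set, and limits along a net are limits along this filter.
\<close>

definition directed_set :: "'i set \<Rightarrow> ('i \<Rightarrow> 'i \<Rightarrow> bool) \<Rightarrow> bool" where
  "directed_set D rel \<longleftrightarrow> D \<noteq> {} \<and> (\<forall>i\<in>D. rel i i) \<and>
     (\<forall>i\<in>D. \<forall>j\<in>D. \<forall>k\<in>D. rel i j \<longrightarrow> rel j k \<longrightarrow> rel i k) \<and>
     (\<forall>i\<in>D. \<forall>j\<in>D. \<exists>k\<in>D. rel i k \<and> rel j k)"

definition tail_filter :: "'i set \<Rightarrow> ('i \<Rightarrow> 'i \<Rightarrow> bool) \<Rightarrow> 'i filter" where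
  "tail_filter D rel = (INF i\<in>D. principal {j\<in>D. rel i j})"

lemma eventually_tail_filter:
  assumes "directed_set D rel"
  shows "eventually P (tail_filter D rel) \<longleftrightarrow> (\<exists>i\<in>D. \<forall>j\<in>D. rel i j \<longrightarrow> P j)"
  unfolding tail_filter_def
proof (subst eventually_INF_base)
  show "D \<noteq> {}" using assms by (simp add: directed_set_def)
  show "\<exists>x\<in>D. principal {j \<in> D. rel x j} \<le> inf (principal {j \<in> D. rel a j}) (principal {j \<in> D. rel b j})"
    if ab: "a \<in> D" "b \<in> D" for a b
  proof -
    obtain c where c: "c \<in> D" "rel a c" "rel b c"
      using assms ab unfolding directed_set_def by blast
    have "rel a j \<and> rel b j" if "j \<in> D" "rel c j" for j
      using assms ab c that unfolding directed_set_def by blast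
    then have "{j \<in> D. rel c j} \<subseteq> {j \<in> D. rel a j} \<inter> {j \<in> D. rel b j}" by auto
    then show ?thesis using c by (auto intro!: bexI[of _ c])
  qed
  show "(\<exists>b\<in>D. eventually P (principal {j \<in> D. rel b j})) \<longleftrightarrow> (\<exists>i\<in>D. \<forall>j\<in>D. rel i j \<longrightarrow> P j)"
    by (auto simp: eventually_principal)
qed

lemma net_imp_filter:
  fixes x :: "'i \<Rightarrow> 'b"
  assumes "directed_set D rel" and "\<And>i. i \<in> D \<Longrightarrow> P (x i)"
  shows "filtermap x (tail_filter D rel) \<noteq> bot" and "eventually P (filtermap x (tail_filter D rel))"
proof -
  obtain i where i: "i \<in> D" using assms(1) unfolding directed_set_def by blast
  have refl: "rel j j" if "j \<in> D" for j using assms(1) that unfolding directed_set_def by blast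
  show "filtermap x (tail_filter D rel) \<noteq> bot"
    unfolding trivial_limit_def eventually_filtermap eventually_tail_filter[OF assms(1)]
    using refl by blast
  show "eventually P (filtermap x (tail_filter D rel))"
    unfolding eventually_filtermap eventually_tail_filter[OF assms(1)]
    using i assms(2) by blast
qed

lemma filter_imp_net:
  fixes F :: "'b filter"
  assumes "F \<noteq> bot" and "eventually P F"
  obtains D :: "('b \<times> 'b set) set" and rel x where
    "directed_set D rel" "\<And>i. i \<in> D \<Longrightarrow> P (x i)" "F = filtermap x (tail_filter D rel)"
proof -
  define D where "D = {(y, S). y \<in> S \<and> eventually (\<lambda>z. z \<in> S) F \<and> S \<subseteq> Collect P}"
  define rel :: "'b \<times> 'b set \<Rightarrow> 'b \<times> 'b set \<Rightarrow> bool" where "rel = (\<lambda>i j. snd j \<subseteq> snd i)"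
  have ne: "\<exists>y. y \<in> S" if "eventually (\<lambda>z. z \<in> S) F" for S
    using eventually_happens'[OF assms(1) that] .
  have evP: "eventually (\<lambda>z. z \<in> Collect P) F" using assms(2) by simp
  have dir: "directed_set D rel"
    unfolding directed_set_def
  proof (intro conjI ballI impI)
    from ne[OF evP] obtain y where "y \<in> Collect P" ..
    then have "(y, Collect P) \<in> D" using evP by (simp add: D_def)
    then show "D \<noteq> {}" by blast
    show "\<exists>k\<in>D. rel i k \<and> rel j k" if ij: "i \<in> D" "j \<in> D" for i j
    proof -
      have ev: "eventually (\<lambda>z. z \<in> snd i \<inter> snd j) F"
        using ij by (auto simp: D_def eventually_conj_iff)
      from ne[OF ev] obtain y where "y \<in> snd i \<inter> snd j" ..
      then have "(y, snd i \<inter> snd j) \<in> D" using ev ij by (auto simp: D_def)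
      then show ?thesis by (rule rev_bexI) (auto simp: rel_def)
    qed
  qed (auto simp: rel_def)
  have "eventually Q F \<longleftrightarrow> eventually Q (filtermap fst (tail_filter D rel))" for Q
    unfolding eventually_filtermap eventually_tail_filter[OF dir]
  proof
    assume "eventually Q F"
    then have ev: "eventually (\<lambda>z. z \<in> {z. P z \<and> Q z}) F"
      using assms(2) by (simp add: eventually_conj_iff)
    from ne[OF ev] obtain y where "P y" "Q y" by blast
    then have "(y, {z. P z \<and> Q z}) \<in> D" using ev by (auto simp: D_def)
    then show "\<exists>i\<in>D. \<forall>j\<in>D. rel i j \<longrightarrow> Q (fst j)"
      by (rule rev_bexI) (auto simp: D_def rel_def)
  next
    assume "\<exists>i\<in>D. \<forall>j\<in>D. rel i j \<longrightarrow> Q (fst j)"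
    then obtain y S where i: "(y, S) \<in> D" "\<And>j. j \<in> D \<Longrightarrow> rel (y, S) j \<Longrightarrow> Q (fst j)" by auto
    have "Q z" if "z \<in> S" for z
      using i(2)[of "(z, S)"] i(1) that by (auto simp: D_def rel_def)
    moreover have "eventually (\<lambda>z. z \<in> S) F" using i(1) by (simp add: D_def)
    ultimately show "eventually Q F" by (auto elim: eventually_mono)
  qed
  then have "F = filtermap fst (tail_filter D rel)" by (simp add: filter_eq_iff)
  moreover have "P (fst i)" if "i \<in> D" for i using that by (auto simp: D_def)
  ultimately show thesis using dir that by blast
qed

section \<open>Algebraic amenability\<close>

text \<open>Dimensions are complex dimensions.\<close>

definition algebraically_amenable :: "'a::cstar_algebra set \<Rightarrow> bool" where
  "algebraically_amenable S \<longleftrightarrow> star_subalgebra S \<and>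
     (\<exists>F :: 'a set filter. F \<noteq> bot \<and>
        eventually (\<lambda>V. csubspace V \<and> (\<exists>B. finite B \<and> V = cspan B) \<and> V \<noteq> {0} \<and> V \<subseteq> S) F \<and>
        (\<forall>A\<in>S. ((\<lambda>V. real (cdim {A * v + w | v w. v \<in> V \<and> w \<in> V}) / real (cdim V)) \<longlongrightarrow> 1) F))"

section \<open>F{\o}lner C*-algebras\<close>

definition euclidean_norm :: "complex vec \<Rightarrow> real" where
  "euclidean_norm v = L2_set (\<lambda>i. cmod (vec_index v i)) {..<dim_vec v}"

definition operator_norm :: "complex mat \<Rightarrow> real" where
  "operator_norm M =
     Sup {euclidean_norm (M *\<^sub>v v) | v. v \<in> carrier_vec (dim_col M) \<and> euclidean_norm v \<le> 1}"

definition normalized_trace :: "complex mat \<Rightarrow> complex" where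
  "normalized_trace M = (\<Sum>i<dim_row M. M $$ (i, i)) / of_nat (dim_row M)"

definition trace_norm2 :: "complex mat \<Rightarrow> real" where
  "trace_norm2 M = sqrt (Re (normalized_trace (mat_adjoint M * M)))"

text \<open>
  Positivity in a C*-algebra means being of the form \<open>b\<^sup>* b\<close>. An \<open>n \<times> n\<close> matrix over \<open>S\<close> is a
  function of two indices, of which only the values below \<open>n\<close> matter, and matrices of size \<open>n\<close>
  with entries in the \<open>k \<times> k\<close> complex matrices are identified with the complex matrices of
  size \<open>n * k\<close> with blocks of size \<open>k\<close>.
\<close>

definition positive_matrix_over :: "'a::cstar_algebra set \<Rightarrow> nat \<Rightarrow> (nat \<Rightarrow> nat \<Rightarrow> 'a) \<Rightarrow> bool" where
  "positive_matrix_over S n X \<longleftrightarrow>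
     (\<exists>B. (\<forall>i<n. \<forall>j<n. B i j \<in> S) \<and>
          (\<forall>i<n. \<forall>j<n. X i j = (\<Sum>l<n. star (B l i) * B l j)))"

definition positive_complex_matrix :: "complex mat \<Rightarrow> bool" where
  "positive_complex_matrix M \<longleftrightarrow>
     (\<exists>B \<in> carrier_mat (dim_row M) (dim_row M). M = mat_adjoint B * B)"

definition amplification ::
    "nat \<Rightarrow> nat \<Rightarrow> ('a \<Rightarrow> complex mat) \<Rightarrow> (nat \<Rightarrow> nat \<Rightarrow> 'a) \<Rightarrow> complex mat" where
  "amplification n k \<phi> X =
     mat (n * k) (n * k) (\<lambda>(r, s). \<phi> (X (r div k) (s div k)) $$ (r mod k, s mod k))"

definition completely_positive ::
    "'a::cstar_algebra set \<Rightarrow> nat \<Rightarrow> ('a \<Rightarrow> complex mat) \<Rightarrow> bool" where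
  "completely_positive S k \<phi> \<longleftrightarrow>
     (\<forall>A\<in>S. \<phi> A \<in> carrier_mat k k) \<and>
     (\<forall>A\<in>S. \<forall>B\<in>S. \<phi> (A + B) = \<phi> A + \<phi> B) \<and>
     (\<forall>c. \<forall>A\<in>S. \<phi> (c *\<^sub>C A) = c \<cdot>\<^sub>m \<phi> A) \<and>
     (\<forall>n X. positive_matrix_over S n X \<longrightarrow> positive_complex_matrix (amplification n k \<phi> X))"

definition ccp_map :: "'a::cstar_algebra set \<Rightarrow> nat \<Rightarrow> ('a \<Rightarrow> complex mat) \<Rightarrow> bool" where
  "ccp_map S k \<phi> \<longleftrightarrow> completely_positive S k \<phi> \<and> (\<forall>A\<in>S. operator_norm (\<phi> A) \<le> norm A)"

definition folner_cstar_algebra :: "'a::cstar_algebra set \<Rightarrow> bool" where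
  "folner_cstar_algebra S \<longleftrightarrow> cstar_subalgebra S \<and>
     (\<exists>F :: ('a \<Rightarrow> complex mat) filter. F \<noteq> bot \<and>
        eventually (\<lambda>\<phi>. \<exists>k>0. ccp_map S k \<phi>) F \<and>
        (\<forall>A\<in>S. \<forall>B\<in>S. ((\<lambda>\<phi>. trace_norm2 (\<phi> (A * B) - \<phi> A * \<phi> B)) \<longlongrightarrow> 0) F) \<and>
        (\<forall>A\<in>S. ((\<lambda>\<phi>. operator_norm (\<phi> A)) \<longlongrightarrow> norm A) F))"

section \<open>The Weyl algebra\<close>

definition symplectic_form :: "('x::real_vector \<Rightarrow> 'x \<Rightarrow> real) \<Rightarrow> bool" where
  "symplectic_form \<sigma> \<longleftrightarrow> bilinear \<sigma> \<and> (\<forall>f g. \<sigma> f g = - \<sigma> g f) \<and>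
     (\<forall>f. (\<forall>g. \<sigma> f g = 0) \<longrightarrow> f = 0)"

definition weyl_elements ::
    "('x::real_vector \<Rightarrow> 'x \<Rightarrow> real) \<Rightarrow> ('x \<Rightarrow> 'a::cstar_algebra) \<Rightarrow> bool" where
  "weyl_elements \<sigma> W \<longleftrightarrow>
     (\<forall>f. unitary_element (W f)) \<and> (\<forall>f. star (W f) = W (- f)) \<and>
     (\<forall>f g. W f * W g = exp (- (\<i> / 2) * complex_of_real (\<sigma> f g)) *\<^sub>C W (f + g))"

text \<open>
  The ambient C*-algebra need not be generated by the Weyl elements: the algebras below are its
  *-subalgebra, respectively C*-subalgebra, generated by them. Taking \<open>weyl_algebra W = UNIV\<close>
  gives the abstract C*-algebra generated by Weyl elements.
\<close>

definition weyl_star_algebra :: "('x \<Rightarrow> 'a::cstar_algebra) \<Rightarrow> 'a set" where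
  "weyl_star_algebra W = star_subalgebra hull range W"

definition weyl_algebra :: "('x \<Rightarrow> 'a::cstar_algebra) \<Rightarrow> 'a set" where
  "weyl_algebra W = closure (weyl_star_algebra W)"

end

theory Submission
  imports Defs
begin

text \<open>
  Write \<open>X\<close> for the symplectic space. Conjugation by \<open>W h\<close> multiplies \<open>W f\<close> by \<open>exp (- \<i> * \<sigma> h f)\<close>.
  As \<open>\<sigma>\<close> is nondegenerate, averaging over suitable conjugations removes any prescribed Weyl element
  other than the unit, and so the coefficient of the unit is a contractive functional on the span of
  the Weyl elements (\<open>unit_coefficient_le_norm\<close>). Hence the Weyl elements are linearly independent,
  and the functional extends to the tracial state \<open>tr\<close> of the Weyl algebra. For the inner product
  \<open>tr (star x * y)\<close> the Weyl elements are orthonormal, and \<open>W b\<close> acts on them as translation by \<open>b\<close> up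
  to phases. Everything is thereby reduced to translations of the abelian group \<open>X\<close>.

  Sums of at most \<open>n\<close> copies of each of finitely many vectors form sets whose size grows polynomially
  in \<open>n\<close>, so that some of them are almost invariant (\<open>foelner_set_exists\<close>). The spans \<open>V\<close> of the
  Weyl elements indexed by a net of such sets prove algebraic amenability, because the dimension of
  \<open>A V + V\<close> exceeds that of \<open>V\<close> by at most the number of points that leave the set.

  For the F{\o}lner property, elements of the Weyl algebra are compressed to the same spans \<open>V\<close>. If \<open>P\<close>
  denotes the orthogonal projection onto \<open>V\<close>, the failure of multiplicativity is \<open>P A (1 - P) B P\<close>. Its
  normalized Hilbert-Schmidt norm is at most the norm of \<open>A\<close> times that of \<open>(1 - P) B P\<close>, which for a
  Weyl element \<open>B\<close> again counts points that leave the set (\<open>compression_mult_defect\<close>,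
  \<open>leakage_tendsto_zero\<close>).

  The compressions can recover the norm in the limit only if the representation on the
  pre-Hilbert space of the trace is isometric. Uniqueness of the C*-norm, usually derived from
  amenability, is replaced by a direct argument (\<open>norm_le_l2_bound\<close>): the powers of \<open>star a * a\<close>, for
  \<open>a\<close> in the span of the Weyl elements, are supported on polynomially many points, so on them the
  norm and the norm of the pre-Hilbert space differ by a polynomial factor only. Along the powers
  \<open>2 ^ k\<close> the C*-identity turns this into an inequality without any factor.
\<close>

section \<open>Elementary facts on C*-algebras\<close>

lemma star_zero [simp]: "star (0 :: 'a::cstar_algebra) = 0"
  using star_add[of "0::'a" 0] by simp

lemma star_diff: "star (x - y) = star x - star (y :: 'a::cstar_algebra)"
  using star_add[of "x - y" y] by (simp add: algebra_simps)

lemma star_sum: "star (sum f I) = (\<Sum>i\<in>I. star (f i :: 'a::cstar_algebra))"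
  by (induction I rule: infinite_finite_induct) (auto simp: star_add)

lemma star_one [simp]: "star (1 :: 'a::cstar_algebra) = 1"
  by (metis mult.right_neutral mult.left_neutral star_mult star_star)

lemma norm_star: "norm (star x) = norm (x :: 'a::cstar_algebra)"
proof -
  have "norm x \<le> norm (star x)" for x :: 'a
  proof (cases "x = 0")
    case False
    have "norm x * norm x \<le> norm (star x) * norm x"
      using norm_mult_ineq[of "star x" x] by (simp add: cstar_identity power2_eq_square)
    then show ?thesis using False by simp
  qed simp
  from this[of x] this[of "star x"] show ?thesis by (simp add: star_star)
qed

lemma norm_unitary: "unitary_element u \<Longrightarrow> norm u = 1"
  using cstar_identity[of u] by (simp add: unitary_element_def power2_eq_1_iff)
    (use norm_ge_zero[of u] in linarith)

lemma tendsto_star: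
  fixes f :: "'i \<Rightarrow> 'a::cstar_algebra"
  assumes "(f \<longlongrightarrow> l) F"
  shows "((\<lambda>n. star (f n)) \<longlongrightarrow> star l) F"
  using assms unfolding tendsto_iff dist_norm star_diff[symmetric] norm_star .

lemma tendsto_scaleC:
  fixes f :: "'i \<Rightarrow> 'a::cstar_algebra"
  assumes "(f \<longlongrightarrow> l) F"
  shows "((\<lambda>n. c *\<^sub>C f n) \<longlongrightarrow> c *\<^sub>C l) F"
proof -
  have "((\<lambda>n. (c *\<^sub>C 1) * f n) \<longlongrightarrow> (c *\<^sub>C 1) * l) F"
    using assms by (intro tendsto_intros)
  then show ?thesis by (simp add: mult_scaleC_left)
qed

lemma sum_scaleC_commute_mult:
  "(\<Sum>i\<in>I. c i *\<^sub>C x i) * y = (\<Sum>i\<in>I. c i *\<^sub>C (x i * (y :: 'a::cstar_algebra)))"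
  "y * (\<Sum>i\<in>I. c i *\<^sub>C x i) = (\<Sum>i\<in>I. c i *\<^sub>C (y * x i))"
  by (simp_all add: sum_distrib_right sum_distrib_left mult_scaleC_left mult_scaleC_right)

section \<open>Exponential against polynomial growth\<close>

lemma power_beats_polynomial:
  fixes t C :: real and d :: nat
  assumes "1 < t"
  shows "\<forall>\<^sub>F n in sequentially. C * (real n + 1) ^ d < t ^ n"
proof -
  \<comment> \<open>The root reduces the claim to linear against exponential growth. Exponent \<open>Suc d\<close> in place of
    \<open>d\<close> makes it meaningful for \<open>d = 0\<close>.\<close>
  define s where "s = root (Suc d) t"
  have s: "1 < s" "s ^ Suc d = t"
    using assms real_root_pow_pos2[of "Suc d" t] by (simp_all add: s_def del: power_Suc)
  have "(\<lambda>n. (real n / s ^ n + inverse (s ^ n)) ^ Suc d) \<longlonglongrightarrow> (0 + 0) ^ Suc d"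
    using s by (intro tendsto_power tendsto_add lim_n_over_pown LIMSEQ_inverse_realpow_zero) auto
  then have "(\<lambda>n. \<bar>C\<bar> * (real n / s ^ n + inverse (s ^ n)) ^ Suc d) \<longlonglongrightarrow> \<bar>C\<bar> * (0 + 0) ^ Suc d"
    by (rule tendsto_mult_left)
  then have "\<forall>\<^sub>F n in sequentially. \<bar>C\<bar> * (real n / s ^ n + inverse (s ^ n)) ^ Suc d < 1"
    by (rule order_tendstoD(2)) simp
  then show ?thesis
  proof eventually_elim
    case (elim n)
    have "s ^ n > 0" using s by simp
    then have "(real n / s ^ n + inverse (s ^ n)) ^ Suc d = (real n + 1) ^ Suc d / (s ^ n) ^ Suc d"
      unfolding power_divide[symmetric] by (simp only: add_divide_distrib inverse_eq_divide)
    also have "(s ^ n) ^ Suc d = t ^ n"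
      by (metis power_mult mult.commute s(2))
    finally have "\<bar>C\<bar> * ((real n + 1) ^ Suc d / t ^ n) < 1"
      using elim by (simp only:)
    moreover have "t ^ n > 0" using assms by simp
    ultimately have "\<bar>C\<bar> * (real n + 1) ^ Suc d < t ^ n"
      by (simp only: times_divide_eq_right pos_divide_less_eq mult_1_left)
    moreover have "C * (real n + 1) ^ d \<le> \<bar>C\<bar> * (real n + 1) ^ Suc d"
      by (rule mult_mono) (auto intro: power_increasing)
    ultimately show ?case by linarith
  qed
qed

text \<open>
  A norm estimate that is lossy by a polynomial factor on the powers \<open>n = 2 ^ k\<close> is sharp. Only these
  exponents are used because the C*-identity gives the norm of \<open>h ^ n\<close> for selfadjoint \<open>h\<close> directly
  for them.
\<close>

lemma le_one_of_dyadic_power_bound: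
  fixes t C :: real and d :: nat
  assumes "\<And>k. t ^ (2 ^ k) \<le> C * (real (2 ^ k) + 1) ^ d"
  shows "t \<le> 1"
proof (rule ccontr)
  assume "\<not> t \<le> 1"
  then obtain N where N: "\<And>n. n \<ge> N \<Longrightarrow> C * (real n + 1) ^ d < t ^ n"
    using power_beats_polynomial[of t C d] by (auto simp: eventually_sequentially)
  have "N \<le> 2 ^ N" by (simp add: less_imp_le)
  from N[OF this] assms[of N] show False by linarith
qed

section \<open>Weyl elements and their Fourier coefficients\<close>

locale weyl_system =
  fixes \<sigma> :: "'x::real_vector \<Rightarrow> 'x \<Rightarrow> real"
    and W :: "'x \<Rightarrow> 'a::cstar_algebra"
  assumes symplectic: "symplectic_form \<sigma>"
    and weyl: "weyl_elements \<sigma> W"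
begin

definition phase :: "'x \<Rightarrow> 'x \<Rightarrow> complex" where
  "phase f g = exp (- (\<i> / 2) * complex_of_real (\<sigma> f g))"

lemma cmod_phase [simp]: "cmod (phase f g) = 1"
proof -
  have "- (\<i> / 2) * complex_of_real (\<sigma> f g) = \<i> * complex_of_real (- \<sigma> f g / 2)" by simp
  then show ?thesis unfolding phase_def by (simp only: norm_exp_i_times)
qed

lemma W_mult: "W f * W g = phase f g *\<^sub>C W (f + g)"
  using weyl by (simp add: weyl_elements_def phase_def)

lemma star_W: "star (W f) = W (- f)"
  using weyl by (simp add: weyl_elements_def)

lemma W_inverse [simp]: "W (- f) * W f = 1" "W f * W (- f) = 1"
  using weyl by (auto simp: weyl_elements_def unitary_element_def)

lemma norm_W [simp]: "norm (W f) = 1"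
  using weyl by (auto simp: weyl_elements_def norm_unitary)

lemma sigma_bilinear: "bilinear \<sigma>"
  using symplectic by (simp add: symplectic_form_def)

lemma sigma_add_left: "\<sigma> (f + g) h = \<sigma> f h + \<sigma> g h"
  and sigma_neg_left: "\<sigma> (- f) g = - \<sigma> f g"
  and sigma_neg_right: "\<sigma> f (- g) = - \<sigma> f g"
  and sigma_scale_left: "\<sigma> (r *\<^sub>R f) g = r * \<sigma> f g"
  and sigma_zero_left: "\<sigma> 0 g = 0"
  using bilinear_ladd[OF sigma_bilinear] bilinear_lneg[OF sigma_bilinear]
    bilinear_rneg[OF sigma_bilinear] bilinear_lmul[OF sigma_bilinear]
    bilinear_lzero[OF sigma_bilinear] by auto

lemma sigma_skew: "\<sigma> f g = - \<sigma> g f"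
  using symplectic unfolding symplectic_form_def by blast

lemma sigma_self [simp]: "\<sigma> f f = 0"
  using sigma_skew[of f f] by simp

lemma W_zero [simp]: "W 0 = 1"
  using W_mult[of 0 0] W_inverse(1)[of 0] by (simp add: phase_def sigma_zero_left scaleC_one)

lemma W_conjugate: "W h * W f * W (- h) = exp (- \<i> * \<sigma> h f) *\<^sub>C W f"
proof -
  have "W h * W f * W (- h) = (phase h f * phase (h + f) (- h)) *\<^sub>C W f"
    by (simp add: W_mult mult_scaleC_left scaleC_scaleC)
  also have "phase h f * phase (h + f) (- h) = exp (- \<i> * \<sigma> h f)"
    by (simp add: phase_def exp_add[symmetric] sigma_add_left sigma_neg_right sigma_skew[of f h])
  finally show ?thesis .
qed

text \<open>
  By \<open>W_conjugate\<close>, conjugating with such a \<open>W h\<close> reverses the sign of \<open>W f\<close>. The value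
  \<open>pi\<close> can be reached exactly because \<open>X\<close> is a real vector space.
\<close>

lemma half_turn_exists:
  assumes "f \<noteq> 0"
  obtains h where "\<sigma> h f = pi"
proof -
  from assms symplectic obtain g where "\<sigma> f g \<noteq> 0"
    unfolding symplectic_form_def by blast
  then have "\<sigma> g f \<noteq> 0" using sigma_skew[of g f] by simp
  then have "\<sigma> ((pi / \<sigma> g f) *\<^sub>R g) f = pi" by (simp add: sigma_scale_left)
  then show ?thesis by (rule that)
qed

text \<open>
  Averaging an element with its conjugate by a half turn for \<open>s\<close> does not increase the norm, keeps
  the coefficient of the unit, and removes the coefficient of \<open>W s\<close>. After finitely many steps only
  the multiple of the unit is left.
\<close>

lemma unit_coefficient_le_norm:
  assumes "finite S" "0 \<notin> S"
  shows "cmod d \<le> norm (d *\<^sub>C 1 + (\<Sum>f\<in>S. c f *\<^sub>C W f))"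
  using assms
proof (induction S arbitrary: c rule: finite_induct)
  case empty
  then show ?case by (simp add: norm_scaleC)
next
  case (insert s S)
  then obtain h where h: "\<sigma> h s = pi" using half_turn_exists[of s] by auto
  define e where "e f = exp (- \<i> * \<sigma> h f)" for f
  have es: "e s = -1" by (simp add: e_def h exp_minus)
  define x where "x = d *\<^sub>C 1 + (\<Sum>f\<in>insert s S. c f *\<^sub>C W f)"
  define y where "y = W h * x * W (- h)"
  have y: "y = d *\<^sub>C 1 + (\<Sum>f\<in>insert s S. (c f * e f) *\<^sub>C W f)"
    unfolding y_def x_def
    by (simp only: distrib_left distrib_right sum_scaleC_commute_mult mult_scaleC_left
        mult_scaleC_right W_conjugate e_def scaleC_scaleC mult_1_right W_inverse)
  have "norm y \<le> norm x"
    unfolding y_def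
    by (rule order_trans[OF norm_mult_ineq]) (use norm_mult_ineq[of "W h" x] in simp)
  then have xy: "norm ((1/2) *\<^sub>C (x + y)) \<le> norm x"
    using norm_triangle_ineq[of x y] by (simp add: norm_scaleC)
  have "(1/2) *\<^sub>C (x + y) =
      d *\<^sub>C 1 + (\<Sum>f\<in>insert s S. (1/2 * (c f + c f * e f)) *\<^sub>C W f)"
  proof -
    have sum_half: "(1/2) *\<^sub>C ((\<Sum>f\<in>insert s S. c f *\<^sub>C W f) + (\<Sum>f\<in>insert s S. (c f * e f) *\<^sub>C W f)) =
        (\<Sum>f\<in>insert s S. (1/2 * (c f + c f * e f)) *\<^sub>C W f)"
      unfolding sum.distrib[symmetric] scaleC_add_left[symmetric] complex_vector.scale_sum_right
        scaleC_scaleC ..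
    have "(1/2) *\<^sub>C (d *\<^sub>C (1::'a) + d *\<^sub>C 1) = d *\<^sub>C 1"
      unfolding scaleC_add_left[symmetric] scaleC_scaleC by simp
    moreover have "x + y = (d *\<^sub>C 1 + d *\<^sub>C 1) +
        ((\<Sum>f\<in>insert s S. c f *\<^sub>C W f) + (\<Sum>f\<in>insert s S. (c f * e f) *\<^sub>C W f))"
      unfolding x_def y by (simp only: ac_simps)
    ultimately show ?thesis
      using sum_half scaleC_add_right[of "1/2" "d *\<^sub>C (1::'a) + d *\<^sub>C 1"] by simp
  qed
  also have "\<dots> = d *\<^sub>C 1 + (\<Sum>f\<in>S. (1/2 * (c f + c f * e f)) *\<^sub>C W f)"
    using insert by (simp add: es)
  finally show ?case
    using xy insert.IH[of "\<lambda>f. 1/2 * (c f + c f * e f)"] insert.prems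
    unfolding x_def[symmetric] by simp
qed

text \<open>
  Multiplication by \<open>W (- g)\<close> moves the coefficient of \<open>W g\<close> to the unit. Linear independence of the
  Weyl elements follows from this bound.
\<close>

lemma coefficient_le_norm:
  assumes "finite S" "g \<in> S"
  shows "cmod (c g) \<le> norm (\<Sum>f\<in>S. c f *\<^sub>C W f)"
proof -
  let ?x = "\<Sum>f\<in>S. c f *\<^sub>C W f"
  let ?S = "(\<lambda>f. - g + f) ` (S - {g})"
  have "W (- g) * ?x = (\<Sum>f\<in>S. (c f * phase (- g) f) *\<^sub>C W (- g + f))"
    by (simp add: sum_scaleC_commute_mult W_mult scaleC_scaleC)
  also have "\<dots> = c g *\<^sub>C 1 + (\<Sum>f\<in>S-{g}. (c f * phase (- g) f) *\<^sub>C W (- g + f))"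
    using assms by (simp add: sum.remove[of S g] phase_def sigma_neg_left)
  also have "(\<Sum>f\<in>S-{g}. (c f * phase (- g) f) *\<^sub>C W (- g + f)) =
      (\<Sum>f\<in>?S. (c (g + f) * phase (- g) (g + f)) *\<^sub>C W f)"
    by (subst sum.reindex) (auto simp: inj_on_def)
  finally have "cmod (c g) \<le> norm (W (- g) * ?x)"
    using unit_coefficient_le_norm[of ?S "c g"] assms(1) by force
  also have "\<dots> \<le> norm ?x" using norm_mult_ineq[of "W (-g)" ?x] by simp
  finally show ?thesis .
qed

lemma inj_W: "inj W"
proof (rule injI, rule ccontr)
  fix f g assume *: "W f = W g" "f \<noteq> g"
  have "cmod ((\<lambda>x. if x = f then 1 else - 1) f) \<le>
    norm (\<Sum>x\<in>{f, g}. (if x = f then 1 else - 1) *\<^sub>C W x)"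
    by (rule coefficient_le_norm) auto
  then show False using * by simp
qed

lemma independent_W: "complex_vector.independent (range W)"
  unfolding complex_vector.dependent_explicit
proof (intro notI, elim exE conjE bexE)
  fix S u v assume S: "finite S" "S \<subseteq> range W" "v \<in> S" "u v \<noteq> 0" "(\<Sum>v\<in>S. u v *\<^sub>C v) = 0"
  then obtain T where T: "S = W ` T" by (auto simp: subset_image_iff)
  have inj: "inj_on W T" using inj_W inj_on_subset by blast
  then have fin: "finite T" using S T finite_imageD by blast
  from S T obtain g where g: "g \<in> T" "v = W g" by auto
  have "(\<Sum>f\<in>T. u (W f) *\<^sub>C W f) = 0" using S(5) T inj by (simp add: sum.reindex)
  then show False using coefficient_le_norm[OF fin g(1), of "\<lambda>f. u (W f)"] g S by simp
qed

lemma independent_W_image: "complex_vector.independent (W ` S)"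
  using independent_W complex_vector.independent_mono[of "range W" "W ` S"] by auto

lemma card_W_image: "card (W ` S) = card S"
  using inj_W by (metis card_image inj_on_subset subset_UNIV)

text \<open>
  The elements of this span are the trigonometric polynomials of the system. By the Weyl relations it
  is already closed under products and adjoints, hence it is the *-algebra generated by the Weyl
  elements.
\<close>

abbreviation trig :: "'a set" where "trig \<equiv> cspan (range W)"

lemma W_in_span: "f \<in> S \<Longrightarrow> W f \<in> cspan (W ` S)"
  by (auto intro: complex_vector.span_base)

lemma W_in_trig [simp]: "W f \<in> trig"
  by (auto intro: complex_vector.span_base)

lemma span_W_finite:
  assumes "finite S" "x \<in> cspan (W ` S)"
  obtains c where "x = (\<Sum>f\<in>S. c f *\<^sub>C W f)"
proof -
  from assms obtain u where "x = (\<Sum>v\<in>W ` S. u v *\<^sub>C v)"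
    by (auto simp: complex_vector.span_finite)
  moreover have "inj_on W S" using inj_W inj_on_subset by blast
  ultimately have "x = (\<Sum>f\<in>S. u (W f) *\<^sub>C W f)" by (simp add: sum.reindex)
  then show ?thesis by (rule that)
qed

lemma trig_finite_support:
  assumes "x \<in> trig"
  obtains S where "finite S" "x \<in> cspan (W ` S)"
proof -
  from assms obtain T u where T: "finite T" "T \<subseteq> range W" "x = (\<Sum>v\<in>T. u v *\<^sub>C v)"
    unfolding complex_vector.span_explicit by blast
  then obtain S where S: "finite S" "T = W ` S" by (auto dest: finite_subset_image)
  have "x \<in> cspan T" unfolding T(3)
    by (intro complex_vector.span_sum complex_vector.span_scale complex_vector.span_base)
  with S that show ?thesis by simp
qed

lemma span_W_mono: "S \<subseteq> T \<Longrightarrow> x \<in> cspan (W ` S) \<Longrightarrow> x \<in> cspan (W ` T)"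
  using complex_vector.span_mono[of "W ` S" "W ` T"] by blast

lemma span_W_trig: "x \<in> cspan (W ` S) \<Longrightarrow> x \<in> trig"
  using span_W_mono[of S UNIV] by simp

lemma span_W_mult:
  assumes "x \<in> cspan (W ` S)" "y \<in> cspan (W ` T)" "\<And>s t. s \<in> S \<Longrightarrow> t \<in> T \<Longrightarrow> s + t \<in> U"
  shows "x * y \<in> cspan (W ` U)"
  using assms(1)
proof (induction x rule: complex_vector.span_induct_alt)
  case base
  then show ?case by (simp add: complex_vector.span_zero)
next
  case (step c v z)
  from step obtain s where s: "s \<in> S" "v = W s" by auto
  have "W s * y \<in> cspan (W ` U)"
    using assms(2)
  proof (induction y rule: complex_vector.span_induct_alt)
    case (step c v z)
    then show ?case
      by (auto simp: distrib_left mult_scaleC_right W_mult scaleC_scaleC s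
          intro!: complex_vector.span_add complex_vector.span_scale W_in_span assms(3))
  qed (simp add: complex_vector.span_zero)
  with step s show ?case
    by (auto simp: distrib_right mult_scaleC_left
          intro!: complex_vector.span_add complex_vector.span_scale)
qed

lemma span_W_star:
  assumes "x \<in> cspan (W ` S)"
  shows "star x \<in> cspan (W ` uminus ` S)"
  using assms
proof (induction x rule: complex_vector.span_induct_alt)
  case base
  then show ?case by (simp add: complex_vector.span_zero)
next
  case (step c v z)
  then show ?case
    by (auto simp: star_add star_scaleC star_W
          intro!: complex_vector.span_add complex_vector.span_scale W_in_span)
qed

lemma star_subalgebra_trig: "star_subalgebra trig"
  using span_W_mult[of _ UNIV _ UNIV UNIV] span_W_star[of _ UNIV] span_W_trig
  by (auto simp: star_subalgebra_def)

lemma weyl_star_algebra_eq: "weyl_star_algebra W = trig"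
  unfolding weyl_star_algebra_def
proof (rule hull_unique)
  show "range W \<subseteq> trig" by auto
  show "star_subalgebra trig" by (rule star_subalgebra_trig)
  show "trig \<subseteq> T" if "range W \<subseteq> T" "star_subalgebra T" for T
    using that by (intro complex_vector.span_minimal) (auto simp: star_subalgebra_def)
qed

end

section \<open>The trace\<close>

context weyl_system
begin

lemma trig_mult: "x \<in> trig \<Longrightarrow> y \<in> trig \<Longrightarrow> x * y \<in> trig"
  and trig_star: "x \<in> trig \<Longrightarrow> star x \<in> trig"
  using star_subalgebra_trig by (auto simp: star_subalgebra_def)

lemma trig_one [simp]: "1 \<in> trig"
  using W_in_trig[of 0] by simp

abbreviation alg :: "'a set" where "alg \<equiv> closure trig"

lemma weyl_algebra_eq: "weyl_algebra W = alg"
  by (simp add: weyl_algebra_def weyl_star_algebra_eq)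

lemma cstar_subalgebra_alg: "cstar_subalgebra alg"
  by (rule cstar_subalgebra_closure[OF star_subalgebra_trig])

lemma subspace_alg: "csubspace alg"
  using cstar_subalgebra_alg by (auto simp: cstar_subalgebra_def star_subalgebra_def)

lemma trig_alg: "x \<in> trig \<Longrightarrow> x \<in> alg"
  using closure_subset by blast

lemma alg_intros [simp, intro]:
  "0 \<in> alg" "1 \<in> alg" "W f \<in> alg"
  "x \<in> alg \<Longrightarrow> y \<in> alg \<Longrightarrow> x + y \<in> alg"
  "x \<in> alg \<Longrightarrow> y \<in> alg \<Longrightarrow> x - y \<in> alg"
  "x \<in> alg \<Longrightarrow> y \<in> alg \<Longrightarrow> x * y \<in> alg"
  "x \<in> alg \<Longrightarrow> c *\<^sub>C x \<in> alg"
  "x \<in> alg \<Longrightarrow> star x \<in> alg"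
  using cstar_subalgebra_alg complex_vector.subspace_0[OF subspace_alg]
    complex_vector.subspace_add[OF subspace_alg] complex_vector.subspace_diff[OF subspace_alg]
    complex_vector.subspace_scale[OF subspace_alg]
  by (auto simp: cstar_subalgebra_def star_subalgebra_def intro: trig_alg)

lemma alg_sum [simp, intro]: "(\<And>i. i \<in> I \<Longrightarrow> x i \<in> alg) \<Longrightarrow> sum x I \<in> alg"
  by (rule complex_vector.subspace_sum[OF subspace_alg])

lemma alg_power [simp, intro]: "x \<in> alg \<Longrightarrow> x ^ n \<in> alg"
  by (induction n) auto

lemma alg_sequence:
  assumes "x \<in> alg"
  obtains u where "\<And>n :: nat. u n \<in> trig" "\<And>n. u n \<in> alg" "u \<longlonglongrightarrow> x"
  using assms trig_alg unfolding closure_sequential by blast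

definition unit_coefficient :: "'a \<Rightarrow> complex" where
  "unit_coefficient x = complex_vector.representation (range W) x 1"

lemma unit_coefficient_W: "unit_coefficient (W f) = of_bool (f = 0)"
  using inj_W by (auto simp: unit_coefficient_def complex_vector.representation_basis[OF independent_W]
      simp flip: W_zero dest: injD)

lemma unit_coefficient_add:
  "x \<in> trig \<Longrightarrow> y \<in> trig \<Longrightarrow> unit_coefficient (x + y) = unit_coefficient x + unit_coefficient y"
  by (simp add: unit_coefficient_def complex_vector.representation_add[OF independent_W])

lemma unit_coefficient_scale:
  "x \<in> trig \<Longrightarrow> unit_coefficient (c *\<^sub>C x) = c * unit_coefficient x"
  by (simp add: unit_coefficient_def complex_vector.representation_scale[OF independent_W])

lemma unit_coefficient_trig_sum:
  assumes "finite S"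
  shows "unit_coefficient (\<Sum>f\<in>S. c f *\<^sub>C W f) = (if 0 \<in> S then c 0 else 0)"
proof -
  have "unit_coefficient (\<Sum>f\<in>S. c f *\<^sub>C W f) = (\<Sum>f\<in>S. unit_coefficient (c f *\<^sub>C W f))"
    unfolding unit_coefficient_def
    by (subst complex_vector.representation_sum[OF independent_W])
       (auto intro: complex_vector.span_scale)
  also have "\<dots> = (\<Sum>f\<in>S. if f = 0 then c f else 0)"
    by (intro sum.cong) (auto simp: unit_coefficient_scale unit_coefficient_W simp del: W_zero)
  finally show ?thesis using assms by simp
qed

lemma cmod_unit_coefficient_le:
  assumes "x \<in> trig"
  shows "cmod (unit_coefficient x) \<le> norm x"
proof -
  obtain S where S: "finite S" "x \<in> cspan (W ` S)" using trig_finite_support[OF assms] .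
  obtain c where "x = (\<Sum>f\<in>S. c f *\<^sub>C W f)" using span_W_finite[OF S] .
  then show ?thesis
    using unit_coefficient_trig_sum[OF S(1), of c] coefficient_le_norm[OF S(1), of 0 c] by simp
qed

text \<open>
  The tracial state of the Weyl algebra: the contractive functional \<open>unit_coefficient\<close>, extended by
  continuity.
\<close>

definition tr :: "'a \<Rightarrow> complex" where
  "tr = (SOME g. continuous_on alg g \<and> (\<forall>x\<in>trig. g x = unit_coefficient x))"

lemma tr_props: "continuous_on alg tr \<and> (\<forall>x\<in>trig. tr x = unit_coefficient x)"
proof -
  have dist: "dist (unit_coefficient y) (unit_coefficient x) \<le> dist y x"
    if "x \<in> trig" "y \<in> trig" for x y
  proof -
    have "unit_coefficient y - unit_coefficient x = unit_coefficient (y - x)"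
      using that
      by (simp add: unit_coefficient_def complex_vector.representation_diff[OF independent_W])
    then show ?thesis
      using cmod_unit_coefficient_le[of "y - x"] that
      by (simp add: dist_norm complex_vector.span_diff)
  qed
  have "uniformly_continuous_on trig unit_coefficient"
    unfolding uniformly_continuous_on_def by (blast intro: le_less_trans[OF dist])
  then have "\<exists>g. continuous_on alg g \<and> (\<forall>x\<in>trig. g x = unit_coefficient x)"
  proof (rule uniformly_continuous_on_extension_on_closure)
    fix g assume "uniformly_continuous_on alg g" "\<And>x. x \<in> trig \<Longrightarrow> unit_coefficient x = g x"
    then show ?thesis using uniformly_continuous_imp_continuous by (intro exI[of _ g]) auto
  qed
  then show ?thesis unfolding tr_def by (rule someI_ex)
qed

lemma tr_trig: "x \<in> trig \<Longrightarrow> tr x = unit_coefficient x"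
  using tr_props by blast

lemma tendsto_tr:
  "u \<longlonglongrightarrow> x \<Longrightarrow> (\<And>n. u n \<in> alg) \<Longrightarrow> x \<in> alg \<Longrightarrow> (\<lambda>n. tr (u n)) \<longlonglongrightarrow> tr x"
  using tr_props by (auto intro: continuous_on_tendsto_compose)

lemma tr_W [simp]: "tr (W f) = of_bool (f = 0)"
  by (simp add: tr_trig unit_coefficient_W)

lemma tr_add:
  assumes "x \<in> alg" "y \<in> alg"
  shows "tr (x + y) = tr x + tr y"
proof -
  obtain u where u: "\<And>n :: nat. u n \<in> trig" "\<And>n. u n \<in> alg" "u \<longlonglongrightarrow> x" using alg_sequence[OF assms(1)] by blast
  obtain v where v: "\<And>n :: nat. v n \<in> trig" "\<And>n. v n \<in> alg" "v \<longlonglongrightarrow> y" using alg_sequence[OF assms(2)] by blast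
  have "(\<lambda>n. tr (u n + v n)) \<longlonglongrightarrow> tr (x + y)"
    using u v assms by (intro tendsto_tr tendsto_add) auto
  moreover have "(\<lambda>n. tr (u n) + tr (v n)) \<longlonglongrightarrow> tr x + tr y"
    using u v assms by (intro tendsto_tr tendsto_add) auto
  moreover have "tr (u n + v n) = tr (u n) + tr (v n)" for n
    using u v by (simp add: tr_trig complex_vector.span_add unit_coefficient_add)
  ultimately show ?thesis using LIMSEQ_unique by auto
qed

lemma tr_scale:
  assumes "x \<in> alg"
  shows "tr (c *\<^sub>C x) = c * tr x"
proof -
  obtain u where u: "\<And>n :: nat. u n \<in> trig" "\<And>n. u n \<in> alg" "u \<longlonglongrightarrow> x" using alg_sequence[OF assms(1)] by blast
  have "(\<lambda>n. tr (c *\<^sub>C u n)) \<longlonglongrightarrow> tr (c *\<^sub>C x)"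
    using u assms by (intro tendsto_tr tendsto_scaleC) auto
  moreover have "(\<lambda>n. c * tr (u n)) \<longlonglongrightarrow> c * tr x"
    using u assms by (intro tendsto_tr tendsto_mult_left) auto
  moreover have "tr (c *\<^sub>C u n) = c * tr (u n)" for n
    using u by (simp add: tr_trig complex_vector.span_scale unit_coefficient_scale)
  ultimately show ?thesis using LIMSEQ_unique by auto
qed

lemma tr_zero [simp]: "tr 0 = 0"
  using tr_scale[of 0 0] by simp

lemma tr_diff: "x \<in> alg \<Longrightarrow> y \<in> alg \<Longrightarrow> tr (x - y) = tr x - tr y"
  using tr_add[of "x - y" y] by simp

lemma tr_sum: "(\<And>i. i \<in> I \<Longrightarrow> x i \<in> alg) \<Longrightarrow> tr (sum x I) = (\<Sum>i\<in>I. tr (x i))"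
  by (induction I rule: infinite_finite_induct) (auto simp: tr_add)

lemma cmod_tr_le:
  assumes "x \<in> alg"
  shows "cmod (tr x) \<le> norm x"
proof -
  obtain u where u: "\<And>n :: nat. u n \<in> trig" "\<And>n. u n \<in> alg" "u \<longlonglongrightarrow> x" using alg_sequence[OF assms(1)] by blast
  have "(\<lambda>n. cmod (tr (u n))) \<longlonglongrightarrow> cmod (tr x)" "(\<lambda>n. norm (u n)) \<longlonglongrightarrow> norm x"
    using u assms by (auto intro!: tendsto_norm tendsto_tr)
  then show ?thesis
    by (rule LIMSEQ_le) (use u cmod_unit_coefficient_le in \<open>auto simp: tr_trig\<close>)
qed

lemma tr_star:
  assumes "x \<in> alg"
  shows "tr (star x) = cnj (tr x)"
proof -
  have *: "tr (star x) = cnj (tr x)" if x: "x \<in> trig" for x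
  proof -
    obtain S where S: "finite S" "x \<in> cspan (W ` S)" using trig_finite_support[OF x] .
    obtain c where c: "x = (\<Sum>f\<in>S. c f *\<^sub>C W f)" using span_W_finite[OF S] .
    show ?thesis unfolding c
      by (auto simp: star_sum star_scaleC star_W tr_sum tr_scale intro!: sum.cong)
  qed
  obtain u where u: "\<And>n :: nat. u n \<in> trig" "\<And>n. u n \<in> alg" "u \<longlonglongrightarrow> x" using alg_sequence[OF assms(1)] by blast
  have "(\<lambda>n. tr (star (u n))) \<longlonglongrightarrow> tr (star x)" "(\<lambda>n. cnj (tr (u n))) \<longlonglongrightarrow> cnj (tr x)"
    using u assms by (auto intro!: tendsto_star tendsto_tr tendsto_cnj)
  then show ?thesis using *[OF u(1)] LIMSEQ_unique by auto
qed

subsection \<open>The pre-Hilbert space of the trace\<close>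

text \<open>
  In this inner product the Weyl elements are orthonormal, and left multiplication by \<open>W b\<close> is the
  translation by \<open>b\<close> up to phases. It plays the part of the Hilbert space of the representation
  associated with the trace.
\<close>

definition l2_inner :: "'a \<Rightarrow> 'a \<Rightarrow> complex" where
  "l2_inner x y = tr (star x * y)"

definition l2_norm :: "'a \<Rightarrow> real" where
  "l2_norm x = sqrt (Re (l2_inner x x))"

lemma l2_inner_W: "l2_inner (W f) (W g) = of_bool (f = g)"
  by (auto simp: l2_inner_def star_W W_mult tr_scale phase_def sigma_neg_left)

lemma l2_inner_cnj: "x \<in> alg \<Longrightarrow> y \<in> alg \<Longrightarrow> l2_inner y x = cnj (l2_inner x y)"
  by (simp add: l2_inner_def tr_star[symmetric] star_mult star_star)

lemma l2_inner_right:
  assumes "x \<in> alg"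
  shows "y \<in> alg \<Longrightarrow> z \<in> alg \<Longrightarrow> l2_inner x (y + z) = l2_inner x y + l2_inner x z"
    and "y \<in> alg \<Longrightarrow> z \<in> alg \<Longrightarrow> l2_inner x (y - z) = l2_inner x y - l2_inner x z"
    and "y \<in> alg \<Longrightarrow> l2_inner x (c *\<^sub>C y) = c * l2_inner x y"
    and "(\<And>i. i \<in> I \<Longrightarrow> w i \<in> alg) \<Longrightarrow> l2_inner x (sum w I) = (\<Sum>i\<in>I. l2_inner x (w i))"
  using assms by (simp_all add: l2_inner_def distrib_left right_diff_distrib tr_add tr_diff
      mult_scaleC_right tr_scale sum_distrib_left tr_sum)

lemma l2_inner_left:
  assumes "x \<in> alg"
  shows "y \<in> alg \<Longrightarrow> z \<in> alg \<Longrightarrow> l2_inner (y + z) x = l2_inner y x + l2_inner z x"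
    and "y \<in> alg \<Longrightarrow> z \<in> alg \<Longrightarrow> l2_inner (y - z) x = l2_inner y x - l2_inner z x"
    and "y \<in> alg \<Longrightarrow> l2_inner (c *\<^sub>C y) x = cnj c * l2_inner y x"
    and "(\<And>i. i \<in> I \<Longrightarrow> w i \<in> alg) \<Longrightarrow> l2_inner (sum w I) x = (\<Sum>i\<in>I. l2_inner (w i) x)"
  using assms by (simp_all add: l2_inner_def distrib_right left_diff_distrib tr_add tr_diff star_add star_diff
      mult_scaleC_left star_scaleC tr_scale star_sum sum_distrib_right tr_sum)

lemma l2_inner_mult_left: "l2_inner (a * x) y = l2_inner x (star a * y)"
  by (simp add: l2_inner_def star_mult mult.assoc)

lemma l2_inner_trig_sums:
  assumes "finite I" "inj_on e I"
  shows "l2_inner (\<Sum>i\<in>I. c i *\<^sub>C W (e i)) (\<Sum>i\<in>I. d i *\<^sub>C W (e i)) = (\<Sum>i\<in>I. cnj (c i) * d i)"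
proof -
  have "l2_inner (\<Sum>i\<in>I. c i *\<^sub>C W (e i)) (\<Sum>i\<in>I. d i *\<^sub>C W (e i)) =
      (\<Sum>j\<in>I. \<Sum>i\<in>I. d j * (cnj (c i) * l2_inner (W (e i)) (W (e j))))"
    by (simp add: l2_inner_left l2_inner_right sum_distrib_left ac_simps)
  also have "\<dots> = (\<Sum>j\<in>I. \<Sum>i\<in>I. if i = j then cnj (c i) * d i else 0)"
    using assms(2) by (intro sum.cong refl) (auto simp: l2_inner_W inj_on_eq_iff)
  finally show ?thesis using assms(1) by simp
qed

lemma l2_inner_self_nonneg:
  assumes "x \<in> alg"
  shows "0 \<le> Re (l2_inner x x)"
proof -
  have *: "0 \<le> Re (l2_inner x x)" if x: "x \<in> trig" for x
  proof -
    obtain S where S: "finite S" "x \<in> cspan (W ` S)" using trig_finite_support[OF x] .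
    obtain c where c: "x = (\<Sum>f\<in>S. c f *\<^sub>C W f)" using span_W_finite[OF S] .
    show ?thesis unfolding c l2_inner_trig_sums[OF S(1) inj_on_id2]
      by (auto intro!: add_nonneg_nonneg sum_nonneg)
  qed
  obtain u where u: "\<And>n :: nat. u n \<in> trig" "\<And>n. u n \<in> alg" "u \<longlonglongrightarrow> x" using alg_sequence[OF assms(1)] by blast
  have "(\<lambda>n. Re (l2_inner (u n) (u n))) \<longlonglongrightarrow> Re (l2_inner x x)"
    unfolding l2_inner_def
    using u assms by (auto intro!: tendsto_star tendsto_tr tendsto_Re tendsto_mult)
  then show ?thesis by (rule LIMSEQ_le_const) (use *[OF u(1)] in auto)
qed

lemma l2_norm_square:
  assumes "x \<in> alg"
  shows "complex_of_real ((l2_norm x)\<^sup>2) = l2_inner x x"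
proof -
  have "Im (l2_inner x x) = 0" using arg_cong[OF l2_inner_cnj[OF assms assms], of Im] by simp
  then show ?thesis
    using l2_inner_self_nonneg[OF assms] by (simp add: l2_norm_def complex_eq_iff)
qed

lemmas l2_norm_square' = l2_norm_square[unfolded of_real_power]

lemma l2_norm_nonneg: "x \<in> alg \<Longrightarrow> 0 \<le> l2_norm x"
  by (simp add: l2_norm_def l2_inner_self_nonneg)

lemma l2_norm_W [simp]: "l2_norm (W f) = 1"
  by (simp add: l2_norm_def l2_inner_W)

lemma l2_norm_scale: "x \<in> alg \<Longrightarrow> l2_norm (c *\<^sub>C x) = cmod c * l2_norm x"
proof -
  assume x: "x \<in> alg"
  have "l2_inner (c *\<^sub>C x) (c *\<^sub>C x) = complex_of_real ((cmod c)\<^sup>2) * l2_inner x x"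
    using x by (simp add: l2_inner_left l2_inner_right complex_norm_square[symmetric] mult.assoc[symmetric])
  then show ?thesis by (simp add: l2_norm_def real_sqrt_mult)
qed

lemma l2_norm_le_norm:
  assumes "x \<in> alg"
  shows "l2_norm x \<le> norm x"
proof -
  have "Re (l2_inner x x) \<le> cmod (l2_inner x x)" by (rule complex_Re_le_cmod)
  also have "\<dots> \<le> (norm x)\<^sup>2"
    using cmod_tr_le[of "star x * x"] assms by (simp add: l2_inner_def cstar_identity)
  finally show ?thesis unfolding l2_norm_def by (simp add: real_le_lsqrt)
qed

lemma l2_inner_add_self:
  assumes "x \<in> alg" "y \<in> alg"
  shows "(l2_norm (x + y))\<^sup>2 = (l2_norm x)\<^sup>2 + (l2_norm y)\<^sup>2 + 2 * Re (l2_inner x y)"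
proof -
  have "complex_of_real ((l2_norm (x + y))\<^sup>2) = l2_inner x x + l2_inner y y + (l2_inner x y + cnj (l2_inner x y))"
    using assms l2_inner_cnj[of x y]
    by (simp only: l2_norm_square alg_intros) (simp add: l2_inner_left l2_inner_right)
  then have "complex_of_real ((l2_norm (x + y))\<^sup>2) =
      complex_of_real ((l2_norm x)\<^sup>2 + (l2_norm y)\<^sup>2 + 2 * Re (l2_inner x y))"
    using assms by (simp only: l2_norm_square[symmetric] complex_add_cnj of_real_add)
  then show ?thesis by (simp only: of_real_eq_iff)
qed

lemma l2_cauchy_schwarz:
  assumes x: "x \<in> alg" and y: "y \<in> alg"
  shows "cmod (l2_inner x y) \<le> l2_norm x * l2_norm y"
proof -
  \<comment> \<open>Positivity at \<open>x - s * cnj (l2_inner x y) * y\<close>. As \<open>y\<close> may be a null vector, \<open>s\<close> is left free: it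
    tends to infinity in that case and is the usual quotient otherwise.\<close>
  have key: "2 * s * (cmod (l2_inner x y))\<^sup>2 \<le> (l2_norm x)\<^sup>2 + s\<^sup>2 * (cmod (l2_inner x y))\<^sup>2 * (l2_norm y)\<^sup>2"
    for s :: real
  proof -
    define c where "c = - (complex_of_real s * cnj (l2_inner x y))"
    have c: "cmod c = \<bar>s\<bar> * cmod (l2_inner x y)" by (simp add: c_def norm_mult)
    have "c * l2_inner x y = complex_of_real (- s * (cmod (l2_inner x y))\<^sup>2)"
      by (simp add: c_def complex_norm_square[symmetric] mult.assoc mult.commute[of "cnj _"])
    then have "Re (l2_inner x (c *\<^sub>C y)) = - s * (cmod (l2_inner x y))\<^sup>2"
      using x y by (simp only: l2_inner_right Re_complex_of_real)
    then have "(l2_norm (x + c *\<^sub>C y))\<^sup>2 =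
        (l2_norm x)\<^sup>2 + s\<^sup>2 * (cmod (l2_inner x y))\<^sup>2 * (l2_norm y)\<^sup>2 - 2 * s * (cmod (l2_inner x y))\<^sup>2"
      using x y by (simp add: l2_inner_add_self l2_norm_scale c power_mult_distrib)
    moreover have "0 \<le> (l2_norm (x + c *\<^sub>C y))\<^sup>2" by simp
    ultimately show ?thesis by linarith
  qed
  have "(cmod (l2_inner x y))\<^sup>2 \<le> (l2_norm x)\<^sup>2 * (l2_norm y)\<^sup>2"
  proof (cases "l2_norm y = 0")
    case True
    have "(cmod (l2_inner x y))\<^sup>2 = 0"
    proof (rule ccontr)
      assume ne: "(cmod (l2_inner x y))\<^sup>2 \<noteq> 0"
      show False
        using key[of "((l2_norm x)\<^sup>2 + 1) / (2 * (cmod (l2_inner x y))\<^sup>2)"] ne True by simp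
    qed
    then show ?thesis by simp
  next
    case False
    define L where "L = (l2_norm y)\<^sup>2"
    have L: "L > 0" using False by (simp add: L_def)
    have "(1 / L)\<^sup>2 * (cmod (l2_inner x y))\<^sup>2 * L = 1 / L * (cmod (l2_inner x y))\<^sup>2"
      using L by (simp add: power2_eq_square)
    then have "(cmod (l2_inner x y))\<^sup>2 / L \<le> (l2_norm x)\<^sup>2"
      using key[of "1 / L"] by (simp flip: L_def)
    then show ?thesis using L by (simp add: pos_divide_le_eq flip: L_def)
  qed
  then show ?thesis
    using x y by (simp add: power_mult_distrib[symmetric] power2_le_iff_abs_le l2_norm_nonneg)
qed

lemma l2_norm_triangle:
  assumes "x \<in> alg" "y \<in> alg"
  shows "l2_norm (x + y) \<le> l2_norm x + l2_norm y"
proof -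
  have "Re (l2_inner x y) \<le> l2_norm x * l2_norm y"
    using l2_cauchy_schwarz[OF assms] complex_Re_le_cmod[of "l2_inner x y"] by linarith
  then have "(l2_norm (x + y))\<^sup>2 \<le> (l2_norm x + l2_norm y)\<^sup>2"
    using assms by (simp add: l2_inner_add_self power2_sum)
  then show ?thesis using assms by (auto intro: power2_le_imp_le simp: l2_norm_nonneg)
qed

lemma star_power_selfadjoint:
  fixes h :: 'a
  assumes "star h = h"
  shows "star (h ^ n) = h ^ n"
  by (induction n) (simp_all add: star_mult assms power_commutes)

lemma norm_power_selfadjoint:
  fixes h :: 'a
  assumes "star h = h"
  shows "norm (h ^ (2 ^ k)) = norm h ^ (2 ^ k)"
proof -
  show ?thesis
  proof (induction k)
    case (Suc k)
    have "norm (h ^ (2 ^ Suc k)) = norm (star (h ^ (2 ^ k)) * h ^ (2 ^ k))"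
      by (simp add: star_power_selfadjoint[OF assms] power_add[symmetric] mult_2)
    also have "\<dots> = norm h ^ (2 ^ Suc k)"
      by (simp add: cstar_identity Suc.IH power_mult[symmetric] mult.commute)
    finally show ?case .
  qed simp
qed

text \<open>
  The order structure of C*-algebras can be avoided here. Cauchy-Schwarz bounds the square of
  \<open>q k = l2_norm (h ^ (2 ^ k) * x)\<close> by \<open>l2_norm x * q (Suc k)\<close>, so that an excess of
  \<open>q 0\<close> over the claimed bound would be amplified by repeated squaring, while the crude bound of \<open>q k\<close>
  by the norm of \<open>h ^ (2 ^ k) * x\<close> only loses a constant factor.
\<close>

lemma l2_norm_selfadjoint_mult_le:
  assumes h: "h \<in> alg" "star h = h" and x: "x \<in> alg"
  shows "l2_norm (h * x) \<le> norm h * l2_norm x"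
proof -
  define q where "q k = l2_norm (h ^ (2 ^ k) * x)" for k :: nat
  have q_nonneg: "0 \<le> q k" for k using h x by (simp add: q_def l2_norm_nonneg)
  note star_power = star_power_selfadjoint[OF h(2)]
  have step: "(q k)\<^sup>2 \<le> l2_norm x * q (Suc k)" for k
  proof -
    have "complex_of_real ((q k)\<^sup>2) = l2_inner x (h ^ (2 ^ Suc k) * x)"
      using h x unfolding q_def
      by (simp add: l2_norm_square' l2_inner_mult_left star_power mult.assoc[symmetric] power_add[symmetric] mult_2)
    then have "(q k)\<^sup>2 = cmod (l2_inner x (h ^ (2 ^ Suc k) * x))"
      by (metis abs_power2 norm_of_real)
    also have "\<dots> \<le> l2_norm x * q (Suc k)"
      unfolding q_def using h x by (intro l2_cauchy_schwarz) auto
    finally show ?thesis .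
  qed
  have bound: "q k \<le> norm h ^ (2 ^ k) * norm x" for k
  proof -
    have "q k \<le> norm (h ^ (2 ^ k) * x)" unfolding q_def using h x by (intro l2_norm_le_norm) auto
    also have "\<dots> \<le> norm h ^ (2 ^ k) * norm x"
      using norm_mult_ineq[of "h ^ (2 ^ k)" x] by (simp add: norm_power_selfadjoint h)
    finally show ?thesis .
  qed
  have iterate: "q 0 ^ (2 ^ k) * l2_norm x \<le> l2_norm x ^ (2 ^ k) * q k" for k
  proof (induction k)
    case (Suc k)
    show ?case
    proof (cases "l2_norm x = 0")
      case False
      then have pos: "l2_norm x > 0" using l2_norm_nonneg[OF x] by simp
      have "(q 0 ^ (2 ^ k) * l2_norm x)\<^sup>2 \<le> (l2_norm x ^ (2 ^ k) * q k)\<^sup>2"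
        using Suc pos q_nonneg by (intro power_mono) auto
      also have "\<dots> \<le> (l2_norm x ^ (2 ^ k))\<^sup>2 * (l2_norm x * q (Suc k))"
        unfolding power_mult_distrib by (intro mult_left_mono step) simp
      finally have "(q 0 ^ (2 ^ Suc k) * l2_norm x) * l2_norm x \<le> (l2_norm x ^ (2 ^ Suc k) * q (Suc k)) * l2_norm x"
        by (simp add: power_mult_distrib power_even_eq power2_eq_square ac_simps)
      then show ?thesis using pos by simp
    qed (use q_nonneg in simp)
  qed simp
  show ?thesis
  proof (cases "l2_norm x = 0")
    case True
    then show ?thesis using step[of 0] h by (simp add: q_def)
  next
    case x0: False
    then have pos: "l2_norm x > 0" using l2_norm_nonneg[OF x] by simp
    show ?thesis
    proof (cases "norm h = 0")
      case False
      then have hpos: "norm h > 0" by simp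
      define t where "t = q 0 / (norm h * l2_norm x)"
      have "t ^ (2 ^ k) \<le> (norm x / l2_norm x) * (real (2 ^ k) + 1) ^ 0" for k
      proof -
        have "q 0 ^ (2 ^ k) * l2_norm x \<le> l2_norm x ^ (2 ^ k) * (norm h ^ (2 ^ k) * norm x)"
          using pos by (intro order_trans[OF iterate] mult_left_mono bound) auto
        then show ?thesis using pos hpos
          by (simp add: t_def power_divide power_mult_distrib field_simps)
      qed
      then have "t \<le> 1" by (rule le_one_of_dyadic_power_bound)
      then show ?thesis using pos hpos by (simp add: t_def q_def field_simps)
    qed (simp add: l2_norm_def l2_inner_def)
  qed
qed

lemma l2_norm_mult_le:
  assumes a: "a \<in> alg" and x: "x \<in> alg"
  shows "l2_norm (a * x) \<le> norm a * l2_norm x"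
proof -
  have "complex_of_real ((l2_norm (a * x))\<^sup>2) = l2_inner x ((star a * a) * x)"
    using a x by (simp add: l2_norm_square' l2_inner_mult_left mult.assoc)
  then have "(l2_norm (a * x))\<^sup>2 = cmod (l2_inner x ((star a * a) * x))"
    by (metis abs_power2 norm_of_real)
  also have "\<dots> \<le> l2_norm x * l2_norm ((star a * a) * x)"
    using a x by (intro l2_cauchy_schwarz) auto
  also have "\<dots> \<le> l2_norm x * ((norm a)\<^sup>2 * l2_norm x)"
    using l2_norm_selfadjoint_mult_le[of "star a * a" x] a x
    by (intro mult_left_mono) (auto simp: star_mult star_star cstar_identity l2_norm_nonneg)
  finally have "(l2_norm (a * x))\<^sup>2 \<le> (norm a * l2_norm x)\<^sup>2"
    by (simp add: power2_eq_square ac_simps)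
  then show ?thesis using x by (auto intro: power2_le_imp_le simp: l2_norm_nonneg)
qed

lemma l2_pythagoras:
  assumes z: "z \<in> alg" and I: "finite I" "inj_on e I"
  shows "(l2_norm (z - (\<Sum>i\<in>I. l2_inner (W (e i)) z *\<^sub>C W (e i))))\<^sup>2 =
    (l2_norm z)\<^sup>2 - (\<Sum>i\<in>I. (cmod (l2_inner (W (e i)) z))\<^sup>2)"
proof -
  let ?c = "\<lambda>i. l2_inner (W (e i)) z"
  define p where "p = (\<Sum>i\<in>I. ?c i *\<^sub>C W (e i))"
  have p: "p \<in> alg" by (auto simp: p_def)
  have pp: "l2_inner p p = (\<Sum>i\<in>I. cnj (?c i) * ?c i)"
    unfolding p_def by (rule l2_inner_trig_sums[OF I])
  moreover have "l2_inner p z = (\<Sum>i\<in>I. cnj (?c i) * ?c i)"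
    unfolding p_def using z by (simp add: l2_inner_left)
  ultimately have pz: "l2_inner p z = l2_inner p p" by simp
  have zp: "l2_inner z p = l2_inner p p"
    using l2_inner_cnj[OF p z] l2_inner_cnj[OF p p] pz by simp
  have "complex_of_real ((l2_norm (z - p))\<^sup>2) = l2_inner z z - l2_inner p p"
    using z p by (simp add: l2_norm_square' l2_inner_left l2_inner_right pz zp)
  also have "l2_inner z z = complex_of_real ((l2_norm z)\<^sup>2)"
    using z by (simp only: l2_norm_square)
  also have "l2_inner p p = complex_of_real (\<Sum>i\<in>I. (cmod (?c i))\<^sup>2)"
    unfolding pp of_real_sum complex_norm_square by (simp add: mult.commute)
  finally have "complex_of_real ((l2_norm (z - p))\<^sup>2) =
      complex_of_real ((l2_norm z)\<^sup>2 - (\<Sum>i\<in>I. (cmod (?c i))\<^sup>2))" by simp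
  then show ?thesis by (simp only: of_real_eq_iff p_def)
qed

end

section \<open>F{\o}lner sets in a real vector space\<close>

text \<open>
  The part of the additive semigroup generated by \<open>T\<close> in which each generator is used at most \<open>n\<close>
  times. Different multiplicities may give the same vector, therefore only upper bounds on its size
  are available; these bounds are polynomial in \<open>n\<close>.
\<close>

definition semigroup_box :: "'x::real_vector set \<Rightarrow> nat \<Rightarrow> 'x set" where
  "semigroup_box T n = (\<lambda>m. \<Sum>t\<in>T. real (m t) *\<^sub>R t) ` (T \<rightarrow>\<^sub>E {..n})"

lemma finite_box: "finite T \<Longrightarrow> finite (semigroup_box T n)"
  unfolding semigroup_box_def by (intro finite_imageI finite_PiE) auto

lemma card_box_le:
  assumes "finite T"
  shows "card (semigroup_box T n) \<le> (n + 1) ^ card T"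
proof -
  have "card (semigroup_box T n) \<le> card (T \<rightarrow>\<^sub>E {..n})"
    unfolding semigroup_box_def using assms by (intro card_image_le finite_PiE) auto
  also have "\<dots> = (n + 1) ^ card T" using assms by (simp add: card_PiE)
  finally show ?thesis .
qed

lemma zero_in_box: "0 \<in> semigroup_box T n"
  unfolding semigroup_box_def by (rule image_eqI[of _ _ "\<lambda>t\<in>T. 0"]) auto

lemma box_mono: "n \<le> n' \<Longrightarrow> semigroup_box T n \<subseteq> semigroup_box T n'"
  unfolding semigroup_box_def by (intro image_mono PiE_mono) auto

lemma box_add:
  assumes "finite T" "x \<in> semigroup_box T n" "t \<in> T"
  shows "t + x \<in> semigroup_box T (Suc n)"
proof -
  from assms(2) obtain m where m: "m \<in> T \<rightarrow>\<^sub>E {..n}" "x = (\<Sum>t\<in>T. real (m t) *\<^sub>R t)"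
    by (auto simp: semigroup_box_def)
  define m' where "m' = m(t := Suc (m t))"
  have "(\<Sum>s\<in>T. real (m' s) *\<^sub>R s) = real (m' t) *\<^sub>R t + (\<Sum>s\<in>T-{t}. real (m' s) *\<^sub>R s)"
    using assms by (simp add: sum.remove)
  also have "(\<Sum>s\<in>T-{t}. real (m' s) *\<^sub>R s) = (\<Sum>s\<in>T-{t}. real (m s) *\<^sub>R s)"
    by (intro sum.cong) (auto simp: m'_def)
  also have "real (m' t) *\<^sub>R t + \<dots> = t + x"
    using assms m(2) by (simp add: sum.remove m'_def algebra_simps)
  finally have "t + x = (\<Sum>s\<in>T. real (m' s) *\<^sub>R s)" ..
  moreover have "m' \<in> T \<rightarrow>\<^sub>E {..Suc n}"
    using m(1) assms(3) by (fastforce simp: m'_def PiE_def extensional_def Pi_def)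
  ultimately show ?thesis unfolding semigroup_box_def by blast
qed

lemma subset_box:
  assumes "finite T" "1 \<le> n"
  shows "T \<subseteq> semigroup_box T n"
  using box_add[OF assms(1) zero_in_box[of T 0]] box_mono[OF assms(2), of T] by auto

text \<open>
  If each box were larger than the previous one by the factor \<open>1 + e\<close>, the boxes would grow
  exponentially, which contradicts the polynomial bound \<open>card_box_le\<close>. A box \<open>F\<close> that grows by a smaller
  factor does the job, since its translates by elements of \<open>T\<close> lie in the next box.
\<close>

lemma foelner_set_exists:
  fixes T :: "'x::real_vector set"
  assumes T: "finite T" and e: "0 < e"
  obtains F where "finite F" "F \<noteq> {}" "T \<subseteq> F"
    "\<And>t. t \<in> T \<Longrightarrow> real (card {g \<in> F. t + g \<notin> F}) \<le> e * real (card F)"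
proof -
  let ?b = "\<lambda>n. real (card (semigroup_box T n))"
  have b1: "1 \<le> ?b n" for n
    using finite_box[OF T, of n] zero_in_box[of T n]
    by (metis One_nat_def Suc_leI card_gt_0_iff empty_iff of_nat_1 of_nat_mono)
  have "\<exists>n\<ge>1. ?b (Suc n) \<le> (1 + e) * ?b n"
  proof (rule ccontr)
    assume "\<not> ?thesis"
    then have grow: "(1 + e) * ?b n < ?b (Suc n)" if "1 \<le> n" for n using that by force
    have low: "(1 + e) ^ n \<le> (1 + e) * ?b n" if "1 \<le> n" for n
      using that
    proof (induction n rule: dec_induct)
      case base
      show ?case using b1[of 1] e by simp
    next
      case (step n)
      have "(1 + e) ^ Suc n \<le> (1 + e) * ((1 + e) * ?b n)"
        using step.IH e by (simp only: power_Suc) (intro mult_left_mono, auto)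
      also have "\<dots> \<le> (1 + e) * ?b (Suc n)"
        using grow[OF step.hyps(1)] e by (intro mult_left_mono) auto
      finally show ?case .
    qed
    have "\<forall>\<^sub>F n in sequentially. (1 + e) * (real n + 1) ^ card T < (1 + e) ^ n"
      using e by (intro power_beats_polynomial) simp
    then obtain N where N: "\<And>n. n \<ge> N \<Longrightarrow> (1 + e) * (real n + 1) ^ card T < (1 + e) ^ n"
      by (auto simp: eventually_sequentially)
    define n where "n = max N 1"
    have "?b n \<le> real ((n + 1) ^ card T)" using card_box_le[OF T, of n] by (simp only: of_nat_le_iff)
    then have "(1 + e) * ?b n \<le> (1 + e) * (real n + 1) ^ card T"
      using e by (intro mult_left_mono) (simp_all add: add.commute)
    with low[of n] N[of n] show False by (auto simp: n_def)
  qed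
  then obtain n where n: "1 \<le> n" "?b (Suc n) \<le> (1 + e) * ?b n" by blast
  show thesis
  proof (rule that)
    show "finite (semigroup_box T n)" "semigroup_box T n \<noteq> {}" "T \<subseteq> semigroup_box T n"
      using finite_box[OF T] zero_in_box[of T n] subset_box[OF T n(1)] by auto
    fix t assume t: "t \<in> T"
    have "card {g \<in> semigroup_box T n. t + g \<notin> semigroup_box T n} = card ((+) t ` {g \<in> semigroup_box T n. t + g \<notin> semigroup_box T n})"
      by (simp add: card_image)
    also have "\<dots> \<le> card (semigroup_box T (Suc n) - semigroup_box T n)"
      using box_add[OF T _ t] finite_box[OF T] by (intro card_mono) auto
    also have "\<dots> = card (semigroup_box T (Suc n)) - card (semigroup_box T n)"
      using finite_box[OF T] box_mono[of n "Suc n" T] by (intro card_Diff_subset) auto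
    finally have "card {g \<in> semigroup_box T n. t + g \<notin> semigroup_box T n} \<le> card (semigroup_box T (Suc n)) - card (semigroup_box T n)" .
    moreover have "card (semigroup_box T n) \<le> card (semigroup_box T (Suc n))"
      using finite_box[OF T] box_mono[of n "Suc n" T] by (intro card_mono) auto
    ultimately have "real (card {g \<in> semigroup_box T n. t + g \<notin> semigroup_box T n}) \<le> ?b (Suc n) - ?b n"
      by linarith
    also have "\<dots> \<le> e * ?b n" using n(2) by (simp add: algebra_simps)
    finally show "real (card {g \<in> semigroup_box T n. t + g \<notin> semigroup_box T n}) \<le> e * ?b n" .
  qed
qed

definition boundary_ratio :: "'x::real_vector \<Rightarrow> 'x list \<Rightarrow> real" where
  "boundary_ratio t xs = real (card {g \<in> set xs. t + g \<notin> set xs}) / real (length xs)"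

text \<open>
  A net of F{\o}lner sets. The sets are given as lists without repetition since an enumeration is needed
  to turn operators into matrices. That the net also exhausts \<open>X\<close> is what makes compressions
  asymptotically isometric.
\<close>

definition foelner_filter :: "'x::real_vector list filter \<Rightarrow> bool" where
  "foelner_filter L \<longleftrightarrow> L \<noteq> bot \<and> (\<forall>\<^sub>F xs in L. distinct xs \<and> xs \<noteq> []) \<and>
     (\<forall>T. finite T \<longrightarrow> (\<forall>\<^sub>F xs in L. T \<subseteq> set xs)) \<and>
     (\<forall>t. (boundary_ratio t \<longlongrightarrow> 0) L)"

lemma foelner_filter_exists: "\<exists>L :: 'x::real_vector list filter. foelner_filter L"
proof -
  define good :: "'x set \<times> nat \<Rightarrow> 'x list \<Rightarrow> bool" where
    "good p xs \<longleftrightarrow> (finite (fst p) \<longrightarrow> distinct xs \<and> xs \<noteq> [] \<and> fst p \<subseteq> set xs \<and>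
      (\<forall>t\<in>fst p. real (card {g \<in> set xs. t + g \<notin> set xs}) \<le> inverse (real (Suc (snd p))) * real (length xs)))"
    for p xs
  have "\<exists>xs. good p xs" for p
  proof (cases "finite (fst p)")
    case True
    obtain F where F: "finite F" "F \<noteq> {}" "fst p \<subseteq> F" "\<And>t. t \<in> fst p \<Longrightarrow>
        real (card {g \<in> F. t + g \<notin> F}) \<le> inverse (real (Suc (snd p))) * real (card F)"
      using foelner_set_exists[OF True, of "inverse (real (Suc (snd p)))"] by auto
    obtain xs where "set xs = F" "distinct xs" using finite_distinct_list[OF F(1)] by blast
    with F show ?thesis by (intro exI[of _ xs]) (auto simp: good_def distinct_card[symmetric])
  qed (simp add: good_def)
  then obtain x where x: "\<And>p. good p (x p)" by metis
  define P where "P = finite_subsets_at_top (UNIV :: 'x set) \<times>\<^sub>F sequentially"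
  have ev: "\<forall>\<^sub>F p in P. finite (fst p) \<and> T \<subseteq> fst p \<and> n \<le> snd p" if "finite T" for T n
  proof -
    have "\<forall>\<^sub>F X in finite_subsets_at_top (UNIV :: 'x set). finite X \<and> T \<subseteq> X"
      using that by (auto simp: eventually_finite_subsets_at_top)
    from eventually_prodI[OF this eventually_ge_at_top[of n]]
    show ?thesis unfolding P_def by (simp add: conj_assoc)
  qed
  show ?thesis
    unfolding foelner_filter_def
  proof (intro exI[of _ "filtermap x P"] conjI allI impI)
    show "filtermap x P \<noteq> bot" by (simp add: P_def filtermap_bot_iff prod_filter_eq_bot)
    show "\<forall>\<^sub>F xs in filtermap x P. distinct xs \<and> xs \<noteq> []"
      unfolding eventually_filtermap using ev[OF finite.emptyI, of 0]
      by (rule eventually_mono) (use x in \<open>auto simp: good_def\<close>)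
    show "\<forall>\<^sub>F xs in filtermap x P. T \<subseteq> set xs" if "finite T" for T
      unfolding eventually_filtermap using ev[OF that, of 0]
      by (rule eventually_mono) (use x in \<open>fastforce simp: good_def\<close>)
    show "(boundary_ratio t \<longlongrightarrow> 0) (filtermap x P)" for t
    proof (rule tendstoI)
      fix e :: real assume "0 < e"
      then obtain n where n: "inverse (real (Suc n)) < e" using reals_Archimedean by blast
      show "\<forall>\<^sub>F xs in filtermap x P. dist (boundary_ratio t xs) 0 < e"
        unfolding eventually_filtermap boundary_ratio_def using ev[OF finite.insertI[OF finite.emptyI], of t n]
      proof (rule eventually_mono)
        fix p assume p: "finite (fst p) \<and> {t} \<subseteq> fst p \<and> n \<le> snd p"
        let ?c = "real (card {g \<in> set (x p). t + g \<notin> set (x p)})"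
        have "?c \<le> inverse (real (Suc (snd p))) * real (length (x p))" "x p \<noteq> []"
          using x[of p] p by (auto simp: good_def)
        then have "?c / real (length (x p)) \<le> inverse (real (Suc (snd p)))"
          by (simp add: pos_divide_le_eq)
        also have "\<dots> \<le> inverse (real (Suc n))" using p by (intro le_imp_inverse_le) auto
        finally show "dist (?c / real (length (x p))) 0 < e" using n by (simp add: dist_norm)
      qed
    qed
  qed
qed

section \<open>Algebraic amenability\<close>

context weyl_system
begin

lemma cdim_span_W: "cdim (cspan (W ` S)) = card S"
  using complex_vector.dim_span_eq_card_independent[OF independent_W_image]
  by (simp add: card_W_image)

text \<open>
  All spaces involved are spanned by Weyl elements, so that dimensions count points: \<open>A\<close> moves the
  points of \<open>F\<close> by elements of \<open>S\<close>, and only those moved out of \<open>F\<close> produce new dimensions.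
\<close>

lemma cdim_image_bounds:
  assumes A: "A \<in> cspan (W ` S)" and S: "finite S" and F: "finite F"
  defines "U \<equiv> {A * v + w | v w. v \<in> cspan (W ` F) \<and> w \<in> cspan (W ` F)}"
  shows "card F \<le> cdim U" "cdim U \<le> card F + (\<Sum>s\<in>S. card {g \<in> F. s + g \<notin> F})"
proof -
  define D where "D s = (+) s ` {g \<in> F. s + g \<notin> F}" for s
  define G where "G = F \<union> (\<Union>s\<in>S. D s)"
  have finG: "finite G" using S F by (auto simp: G_def D_def)
  have UG: "U \<subseteq> cspan (W ` G)"
  proof
    fix u assume "u \<in> U"
    then obtain v w where u: "u = A * v + w" "v \<in> cspan (W ` F)" "w \<in> cspan (W ` F)"
      by (auto simp: U_def)
    have "A * v \<in> cspan (W ` G)"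
      by (rule span_W_mult[OF A u(2)]) (auto simp: G_def D_def)
    moreover have "w \<in> cspan (W ` G)" by (rule span_W_mono[OF _ u(3)]) (auto simp: G_def)
    ultimately show "u \<in> cspan (W ` G)" unfolding u(1) by (rule complex_vector.span_add)
  qed
  have WU: "W ` F \<subseteq> U"
  proof
    fix y assume "y \<in> W ` F"
    then have "y \<in> cspan (W ` F)" by (rule complex_vector.span_base)
    then show "y \<in> U" unfolding U_def
      by (intro CollectI exI[of _ "0::'a"] exI[of _ y]) (simp add: complex_vector.span_zero)
  qed
  obtain B where B: "W ` F \<subseteq> B" "B \<subseteq> U" "complex_vector.independent B" "U \<subseteq> cspan B"
    using complex_vector.maximal_independent_subset_extend[OF WU independent_W_image] .
  have "finite B"
    using complex_vector.independent_span_bound[of "W ` G" B] B finG UG by auto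
  then have "card (W ` F) \<le> card B" using B(1) by (rule card_mono)
  then show "card F \<le> cdim U"
    using complex_vector.basis_card_eq_dim[OF B(2,4,3)] by (simp add: card_W_image)
  have "cdim U \<le> card (W ` G)"
    using UG finG by (intro complex_vector.dim_le_card) auto
  also have "\<dots> = card G" by (rule card_W_image)
  also have "\<dots> \<le> card F + card (\<Union>s\<in>S. D s)" unfolding G_def by (rule card_Un_le)
  also have "card (\<Union>s\<in>S. D s) \<le> (\<Sum>s\<in>S. card (D s))" using S by (rule card_UN_le)
  also have "(\<Sum>s\<in>S. card (D s)) = (\<Sum>s\<in>S. card {g \<in> F. s + g \<notin> F})"
    by (simp add: D_def card_image)
  finally show "cdim U \<le> card F + (\<Sum>s\<in>S. card {g \<in> F. s + g \<notin> F})" by simp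
qed

theorem algebraically_amenable_trig: "algebraically_amenable trig"
proof -
  obtain L :: "'x list filter" where "foelner_filter L"
    using foelner_filter_exists ..
  then have L: "L \<noteq> bot" "\<forall>\<^sub>F xs in L. distinct xs \<and> xs \<noteq> []" "(boundary_ratio t \<longlongrightarrow> 0) L" for t
    by (simp_all add: foelner_filter_def)
  define V where "V xs = cspan (W ` set xs)" for xs
  show ?thesis unfolding algebraically_amenable_def
  proof (intro conjI exI[of _ "filtermap V L"] ballI)
    show "star_subalgebra trig" by (rule star_subalgebra_trig)
    show "filtermap V L \<noteq> bot" using L(1) by (simp add: filtermap_bot_iff)
    show "\<forall>\<^sub>F V in filtermap V L.
       csubspace V \<and> (\<exists>B. finite B \<and> V = cspan B) \<and> V \<noteq> {0} \<and> V \<subseteq> trig"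
      unfolding eventually_filtermap using L(2)
    proof (rule eventually_mono)
      fix xs :: "'x list" assume "distinct xs \<and> xs \<noteq> []"
      then have "W (hd xs) \<in> V xs" unfolding V_def by (intro W_in_span) auto
      moreover have "W (hd xs) \<noteq> 0" using norm_W[of "hd xs"] by (metis norm_zero zero_neq_one)
      ultimately show "csubspace (V xs) \<and> (\<exists>B. finite B \<and> V xs = cspan B) \<and> V xs \<noteq> {0} \<and> V xs \<subseteq> trig"
        using span_W_trig by (auto simp: V_def)
    qed
    fix A assume "A \<in> trig"
    then obtain S where S: "finite S" "A \<in> cspan (W ` S)" using trig_finite_support by blast
    define r where "r V = real (cdim {A * v + w | v w. v \<in> V \<and> w \<in> V}) / real (cdim V)" for V
    define q where "q xs = (\<Sum>s\<in>S. boundary_ratio s xs)" for xs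
    have bounds: "1 \<le> r (V xs) \<and> r (V xs) \<le> 1 + q xs" if xs: "distinct xs \<and> xs \<noteq> []" for xs
    proof -
      define d where "d = cdim {A * v + w | v w. v \<in> V xs \<and> w \<in> V xs}"
      have n: "cdim (V xs) = length xs" "length xs > 0"
        using xs by (simp_all add: V_def cdim_span_W distinct_card del: complex_vector.dim_span)
      have "length xs \<le> d" "d \<le> length xs + (\<Sum>s\<in>S. card {g \<in> set xs. s + g \<notin> set xs})"
        using cdim_image_bounds[OF S(2,1), of "set xs"] xs by (simp_all add: V_def d_def distinct_card)
      moreover from of_nat_mono[OF this(2), where 'a = real]
      have "real d \<le> real (length xs) + (\<Sum>s\<in>S. real (card {g \<in> set xs. s + g \<notin> set xs}))"
        by simp
      ultimately have "real (length xs) \<le> real d"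
        "real d \<le> real (length xs) + (\<Sum>s\<in>S. boundary_ratio s xs) * real (length xs)"
        using n(2) by (simp_all add: boundary_ratio_def sum_divide_distrib[symmetric])
      then have "1 \<le> real d / real (length xs)"
        "real d / real (length xs) \<le> 1 + (\<Sum>s\<in>S. boundary_ratio s xs)"
        using n(2) by (simp_all add: pos_le_divide_eq pos_divide_le_eq distrib_right)
      then show ?thesis unfolding r_def q_def n(1) d_def[symmetric] by simp
    qed
    have "(q \<longlongrightarrow> (\<Sum>s\<in>S. 0)) L" unfolding q_def by (intro tendsto_sum L(3))
    then have "((\<lambda>xs. 1 + q xs) \<longlongrightarrow> 1) L" using tendsto_add[OF tendsto_const, of q 0 L 1] by simp
    then have "((\<lambda>xs. r (V xs)) \<longlongrightarrow> 1) L"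
      by (rule tendsto_sandwich[OF _ _ tendsto_const, rotated 2])
         (rule eventually_mono[OF L(2)]; simp add: bounds)+
    then show "((\<lambda>V. real (cdim {A * v + w | v w. v \<in> V \<and> w \<in> V}) / real (cdim V)) \<longlongrightarrow> 1) (filtermap V L)"
      unfolding r_def[symmetric] by (simp add: filterlim_filtermap)
  qed
qed

end

section \<open>Matrix norms\<close>

lemma dim_mat_adjoint [simp]:
  "dim_row (mat_adjoint A) = dim_col A" "dim_col (mat_adjoint A) = dim_row A"
  by (simp_all add: mat_adjoint_def)

lemma index_mat_adjoint:
  "i < dim_col A \<Longrightarrow> j < dim_row A \<Longrightarrow> mat_adjoint A $$ (i, j) = cnj (A $$ (j, i))"
  by (simp add: mat_adjoint_def mat_of_rows_index)

lemma trace_norm2_eq: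
  assumes "M \<in> carrier_mat k k"
  shows "trace_norm2 M = sqrt ((\<Sum>j<k. \<Sum>i<k. (cmod (M $$ (i, j)))\<^sup>2) / real k)"
proof -
  have "(mat_adjoint M * M) $$ (j, j) = complex_of_real (\<Sum>i<k. (cmod (M $$ (i, j)))\<^sup>2)"
    if "j < k" for j
    using assms that
    by (simp add: scalar_prod_def index_mat_adjoint lessThan_atLeast0 complex_norm_square
        mult.commute del: of_real_power)
  then have "normalized_trace (mat_adjoint M * M) =
      complex_of_real ((\<Sum>j<k. \<Sum>i<k. (cmod (M $$ (i, j)))\<^sup>2) / real k)"
    using assms by (simp add: normalized_trace_def del: of_real_power)
  then show ?thesis by (simp add: trace_norm2_def del: of_real_power of_real_divide of_real_sum)
qed

lemma euclidean_norm_nonneg: "0 \<le> euclidean_norm v"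
  by (simp add: euclidean_norm_def L2_set_nonneg)

lemma euclidean_norm_smult: "euclidean_norm (c \<cdot>\<^sub>v v) = cmod c * euclidean_norm v"
  unfolding euclidean_norm_def L2_set_right_distrib[OF norm_ge_zero]
  by (intro L2_set_cong) (simp_all add: norm_mult)

lemma euclidean_norm_zero: "euclidean_norm (0\<^sub>v n) = 0"
  by (simp add: euclidean_norm_def L2_set_def)

lemma operator_norm_le:
  assumes M: "M \<in> carrier_mat k k" and C: "0 \<le> C"
    and bound: "\<And>v. v \<in> carrier_vec k \<Longrightarrow> euclidean_norm (M *\<^sub>v v) \<le> C * euclidean_norm v"
  shows "operator_norm M \<le> C"
  unfolding operator_norm_def
proof (rule cSup_least)
  show "{euclidean_norm (M *\<^sub>v v) |v. v \<in> carrier_vec (dim_col M) \<and> euclidean_norm v \<le> 1} \<noteq> {}"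
    by (auto intro!: exI[of _ "0\<^sub>v (dim_col M)"] simp: euclidean_norm_zero)
  fix x assume "x \<in> {euclidean_norm (M *\<^sub>v v) |v. v \<in> carrier_vec (dim_col M) \<and> euclidean_norm v \<le> 1}"
  then obtain v where v: "x = euclidean_norm (M *\<^sub>v v)" "v \<in> carrier_vec k" "euclidean_norm v \<le> 1"
    using M by auto
  have "x \<le> C * euclidean_norm v" unfolding v(1) by (rule bound[OF v(2)])
  also have "\<dots> \<le> C" using v(3) C by (simp add: mult_left_le)
  finally show "x \<le> C" .
qed

lemma le_operator_norm:
  assumes M: "M \<in> carrier_mat k k"
    and bound: "\<And>v. v \<in> carrier_vec k \<Longrightarrow> euclidean_norm (M *\<^sub>v v) \<le> C * euclidean_norm v"
    and C: "0 \<le> C" and v: "v \<in> carrier_vec k"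
  shows "euclidean_norm (M *\<^sub>v v) \<le> operator_norm M * euclidean_norm v"
proof (cases "euclidean_norm v = 0")
  case True
  then show ?thesis using bound[OF v] by simp
next
  case False
  then have pos: "euclidean_norm v > 0" using euclidean_norm_nonneg[of v] by simp
  let ?S = "{euclidean_norm (M *\<^sub>v v) |v. v \<in> carrier_vec (dim_col M) \<and> euclidean_norm v \<le> 1}"
  have bdd: "bdd_above ?S"
  proof (rule bdd_aboveI)
    fix x assume "x \<in> ?S"
    then obtain u where u: "x = euclidean_norm (M *\<^sub>v u)" "u \<in> carrier_vec k" "euclidean_norm u \<le> 1"
      using M by auto
    show "x \<le> C" using bound[OF u(2)] mult_left_mono[OF u(3) C] u(1) by simp
  qed
  define u where "u = complex_of_real (1 / euclidean_norm v) \<cdot>\<^sub>v v"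
  have u: "u \<in> carrier_vec k" "euclidean_norm u \<le> 1"
    using v pos by (simp_all add: u_def euclidean_norm_smult norm_divide)
  have "M *\<^sub>v u = complex_of_real (1 / euclidean_norm v) \<cdot>\<^sub>v (M *\<^sub>v v)"
    unfolding u_def using M v by (rule mult_mat_vec)
  then have "euclidean_norm (M *\<^sub>v u) = euclidean_norm (M *\<^sub>v v) / euclidean_norm v"
    using pos by (simp add: euclidean_norm_smult norm_divide)
  moreover have "euclidean_norm (M *\<^sub>v u) \<le> operator_norm M"
    unfolding operator_norm_def using u M by (intro cSup_upper bdd) auto
  ultimately show ?thesis using pos by (simp add: pos_divide_le_eq)
qed

section \<open>Compressions of the Weyl algebra\<close>

context weyl_system
begin

text \<open>
  The matrix of \<open>P A P\<close>, where \<open>P\<close> is the orthogonal projection, for \<open>l2_inner\<close>, onto the span of the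
  Weyl elements indexed by \<open>xs\<close>.
\<close>

definition compression :: "'x list \<Rightarrow> 'a \<Rightarrow> complex mat" where
  "compression xs A = mat (length xs) (length xs) (\<lambda>(i, j). l2_inner (W (xs ! i)) (A * W (xs ! j)))"

definition synthesis :: "'x list \<Rightarrow> complex vec \<Rightarrow> 'a" where
  "synthesis xs v = (\<Sum>i<length xs. vec_index v i *\<^sub>C W (xs ! i))"

definition projected_norm :: "'x list \<Rightarrow> 'a \<Rightarrow> real" where
  "projected_norm xs z = L2_set (\<lambda>i. cmod (l2_inner (W (xs ! i)) z)) {..<length xs}"

lemma compression_carrier [simp]: "compression xs A \<in> carrier_mat (length xs) (length xs)"
  by (simp add: compression_def)

lemma dim_compression [simp]:
  "dim_row (compression xs A) = length xs" "dim_col (compression xs A) = length xs"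
  by (simp_all add: compression_def)

lemma compression_index:
  "i < length xs \<Longrightarrow> j < length xs \<Longrightarrow>
    compression xs A $$ (i, j) = l2_inner (W (xs ! i)) (A * W (xs ! j))"
  by (simp add: compression_def)

lemma synthesis_alg [simp]: "synthesis xs v \<in> alg"
  by (auto simp: synthesis_def)

lemma inj_on_nth_lessThan: "distinct xs \<Longrightarrow> inj_on ((!) xs) {..<length xs}"
  by (rule inj_on_nth) auto

lemma l2_norm_trig_sum:
  assumes "finite I" "inj_on e I"
  shows "l2_norm (\<Sum>i\<in>I. c i *\<^sub>C W (e i)) = L2_set (\<lambda>i. cmod (c i)) I"
proof -
  have "Re (cnj z * z) = (cmod z)\<^sup>2" for z
    by (simp add: cmod_power2) (simp add: power2_eq_square)
  then show ?thesis unfolding l2_norm_def l2_inner_trig_sums[OF assms] Re_sum L2_set_def by simp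
qed

lemma l2_norm_synthesis:
  assumes "distinct xs" "v \<in> carrier_vec (length xs)"
  shows "l2_norm (synthesis xs v) = euclidean_norm v"
  using l2_norm_trig_sum[OF finite_lessThan inj_on_nth_lessThan[OF assms(1)]] assms(2)
  by (simp add: synthesis_def euclidean_norm_def)

lemma compression_apply:
  assumes "A \<in> alg" "v \<in> carrier_vec (length xs)"
  shows "euclidean_norm (compression xs A *\<^sub>v v) = projected_norm xs (A * synthesis xs v)"
proof -
  have "vec_index (compression xs A *\<^sub>v v) i = l2_inner (W (xs ! i)) (A * synthesis xs v)"
    if "i < length xs" for i
    using assms that
    by (simp add: scalar_prod_def compression_index synthesis_def sum_distrib_left mult_scaleC_right
        l2_inner_right lessThan_atLeast0 mult.commute)
  then show ?thesis
    unfolding euclidean_norm_def projected_norm_def by (intro L2_set_cong) simp_all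
qed

lemma projected_norm_nonneg: "0 \<le> projected_norm xs z"
  by (simp add: projected_norm_def L2_set_nonneg)

lemma projected_norm_le:
  assumes "distinct xs" "z \<in> alg"
  shows "projected_norm xs z \<le> l2_norm z"
proof -
  have "0 \<le> (l2_norm z)\<^sup>2 - (\<Sum>i<length xs. (cmod (l2_inner (W (xs ! i)) z))\<^sup>2)"
    using l2_pythagoras[OF assms(2) _ inj_on_nth_lessThan[OF assms(1)]]
    by (metis finite_lessThan zero_le_power2)
  then show ?thesis
    unfolding projected_norm_def L2_set_def using assms(2)
    by (intro real_le_lsqrt) (auto simp: l2_norm_nonneg intro!: sum_nonneg)
qed

lemma projected_norm_triangle:
  assumes "z \<in> alg" "w \<in> alg"
  shows "projected_norm xs (z + w) \<le> projected_norm xs z + projected_norm xs w"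
  unfolding projected_norm_def using assms
  by (intro order_trans[OF _ L2_set_triangle_ineq] L2_set_mono)
     (auto simp: l2_inner_right norm_triangle_ineq)

lemma span_W_coordinates:
  assumes xs: "distinct xs" and z: "z \<in> cspan (W ` set xs)"
  shows "z = synthesis xs (vec (length xs) (\<lambda>i. l2_inner (W (xs ! i)) z))"
proof -
  obtain c where "z = (\<Sum>f\<in>set xs. c f *\<^sub>C W f)" using span_W_finite[OF _ z] by auto
  also have "\<dots> = (\<Sum>i<length xs. c (xs ! i) *\<^sub>C W (xs ! i))"
    using sum.reindex_bij_betw[OF bij_betw_nth[OF xs refl refl], of "\<lambda>f. c f *\<^sub>C W f"] by simp
  finally have c: "z = (\<Sum>i<length xs. c (xs ! i) *\<^sub>C W (xs ! i))" .
  have "l2_inner (W (xs ! i)) z = c (xs ! i)" if i: "i < length xs" for i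
  proof -
    have "l2_inner (W (xs ! i)) z = (\<Sum>j<length xs. if i = j then c (xs ! j) else 0)"
      unfolding c using xs i
      by (subst l2_inner_right(4)) (auto simp: l2_inner_right l2_inner_W nth_eq_iff_index_eq intro!: sum.cong)
    then show ?thesis using i by simp
  qed
  then show ?thesis by (subst c) (simp add: synthesis_def)
qed

lemma projected_norm_span:
  assumes xs: "distinct xs" and z: "z \<in> cspan (W ` set xs)"
  shows "projected_norm xs z = l2_norm z"
proof -
  let ?v = "vec (length xs) (\<lambda>i. l2_inner (W (xs ! i)) z)"
  have "l2_norm z = l2_norm (synthesis xs ?v)" using span_W_coordinates[OF xs z] by simp
  also have "\<dots> = euclidean_norm ?v" by (rule l2_norm_synthesis[OF xs]) simp
  also have "\<dots> = projected_norm xs z"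
    unfolding euclidean_norm_def projected_norm_def by (intro L2_set_cong) simp_all
  finally show ?thesis ..
qed

lemma compression_bound:
  assumes xs: "distinct xs" and A: "A \<in> alg" and v: "v \<in> carrier_vec (length xs)"
  shows "euclidean_norm (compression xs A *\<^sub>v v) \<le> norm A * euclidean_norm v"
proof -
  have "euclidean_norm (compression xs A *\<^sub>v v) \<le> l2_norm (A * synthesis xs v)"
    unfolding compression_apply[OF A v] using xs A by (intro projected_norm_le) auto
  also have "\<dots> \<le> norm A * euclidean_norm v"
    using l2_norm_mult_le[OF A synthesis_alg] l2_norm_synthesis[OF xs v] by metis
  finally show ?thesis .
qed

lemma compression_contractive:
  "distinct xs \<Longrightarrow> A \<in> alg \<Longrightarrow> operator_norm (compression xs A) \<le> norm A"
  by (rule operator_norm_le[OF compression_carrier]) (auto intro: compression_bound)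

subsection \<open>Complete positivity\<close>

text \<open>
  Complete positivity asks for a square factor, whereas a Gram matrix comes with as many summands as
  the vectors have components. This is the Cholesky factorization, found by splitting off from all
  vectors their component along the last one; \<open>y\<close> are the remainders. If the last vector is null,
  Cauchy-Schwarz makes its whole row vanish, in agreement with \<open>x / 0 = 0\<close>.
\<close>

lemma gram_factorization:
  fixes z :: "nat \<Rightarrow> nat \<Rightarrow> 'a" and m n :: nat
  assumes "\<And>l i. z l i \<in> alg"
  shows "\<exists>B :: nat \<Rightarrow> nat \<Rightarrow> complex. \<forall>i<m. \<forall>j<m.
    (\<Sum>l<n. l2_inner (z l i) (z l j)) = (\<Sum>l<m. cnj (B l i) * B l j)"
  using assms
proof (induction m arbitrary: z)
  case 0
  then show ?case by simp
next
  case (Suc m)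
  note z = Suc.prems
  define G where "G i j = (\<Sum>l<n. l2_inner (z l i) (z l j))" for i j
  define s where "s = (\<Sum>l<n. (l2_norm (z l m))\<^sup>2)"
  \<comment> \<open>the coefficient of the component of the \<open>j\<close>-th vector along the last one\<close>
  define c where "c j = G m j / G m m" for j
  have Gmm: "G m m = complex_of_real s"
    using z by (simp add: G_def s_def l2_norm_square')
  have s: "0 \<le> s" by (auto simp: s_def intro!: sum_nonneg)
  have cnjG: "G i j = cnj (G j i)" for i j
    using z by (simp add: G_def l2_inner_cnj[of "z _ i" "z _ j"])
  have Gm: "G m j = c j * G m m" for j
  proof (cases "s = 0")
    case True
    then have "l2_norm (z l m) = 0" if "l < n" for l
      using that sum_nonneg_0[of "{..<n}" "\<lambda>l. (l2_norm (z l m))\<^sup>2" l] by (simp add: s_def)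
    then have "l2_inner (z l m) (z l j) = 0" if "l < n" for l
      using that l2_cauchy_schwarz[OF z z, of l m l j] by simp
    then have "G m j = 0" by (simp add: G_def)
    then show ?thesis by (simp add: c_def)
  qed (simp add: c_def Gmm)
  have Gm': "G i m = cnj (c i) * G m m" for i
    using cnjG[of i m] Gm[of i] Gmm by simp
  define y where "y l i = z l i - c i *\<^sub>C z l m" for l i
  have y: "y l i \<in> alg" for l i using z by (simp add: y_def)
  have Gy: "(\<Sum>l<n. l2_inner (y l i) (y l j)) = G i j - cnj (c i) * c j * G m m" for i j
  proof -
    have "(\<Sum>l<n. l2_inner (y l i) (y l j)) =
        G i j - c j * G i m - cnj (c i) * G m j + cnj (c i) * c j * G m m"
      unfolding y_def G_def using z
      by (simp add: l2_inner_left l2_inner_right sum.distrib sum_subtractf sum_distrib_left algebra_simps)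
    then show ?thesis unfolding Gm[of j] Gm'[of i] by (simp add: algebra_simps)
  qed
  obtain B where B: "\<forall>i<m. \<forall>j<m.
      G i j - cnj (c i) * c j * G m m = (\<Sum>l<m. cnj (B l i) * B l j)"
    using Suc.IH[of y, OF y] unfolding Gy ..
  define B' where "B' l i = (if l < m then (if i < m then B l i else 0) else complex_of_real (sqrt s) * c i)"
    for l i
  have sqrt_s: "complex_of_real (sqrt s) * complex_of_real (sqrt s) = G m m"
    using s unfolding Gmm by (simp flip: of_real_mult)
  have cm: "G m m * c m = G m m" by (simp add: c_def)
  have "G i j = (\<Sum>l<Suc m. cnj (B' l i) * B' l j)" if ij: "i < Suc m" "j < Suc m" for i j
  proof -
    have "(\<Sum>l<Suc m. cnj (B' l i) * B' l j) =
        (\<Sum>l<m. cnj (B' l i) * B' l j) + cnj (c i) * c j * G m m"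
      by (simp add: B'_def sqrt_s[symmetric])
    also have "\<dots> = G i j"
    proof (cases "i < m \<and> j < m")
      case True
      then show ?thesis using B[rule_format, of i j, symmetric] by (simp add: B'_def)
    next
      case False
      then have "(\<Sum>l<m. cnj (B' l i) * B' l j) = 0" by (auto simp: B'_def)
      moreover have "cnj (c m) * G m m = G m m"
        using arg_cong[OF cm, of cnj] by (simp add: Gmm mult.commute)
      then have "cnj (c i) * c j * G m m = G i j"
        using False ij Gm[of j] Gm'[of i] cm by (auto simp: less_Suc_eq ac_simps)
      ultimately show ?thesis by simp
    qed
    finally show ?thesis ..
  qed
  then show ?case unfolding G_def by blast
qed

text \<open>
  A positive matrix over the algebra is turned into the Gram matrix of the vectors \<open>B l i * W f\<close>, where
  the position \<open>r\<close> in the amplified matrix encodes the pair of \<open>i = r div k\<close> and the \<open>r mod k\<close>-th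
  element \<open>f\<close> of \<open>xs\<close>.
\<close>

lemma compression_completely_positive: "completely_positive alg (length xs) (compression xs)"
  unfolding completely_positive_def
proof (intro conjI ballI allI impI)
  let ?k = "length xs"
  show "compression xs A \<in> carrier_mat ?k ?k" for A by simp
  show "compression xs (A + B) = compression xs A + compression xs B" if "A \<in> alg" "B \<in> alg" for A B
    using that by (intro eq_matI) (auto simp: compression_index distrib_right l2_inner_right)
  show "compression xs (c *\<^sub>C A) = c \<cdot>\<^sub>m compression xs A" if "A \<in> alg" for c A
    using that by (intro eq_matI) (auto simp: compression_index mult_scaleC_left l2_inner_right)
  fix n X assume "positive_matrix_over alg n X"
  then obtain B where B: "\<And>i j. i < n \<Longrightarrow> j < n \<Longrightarrow> B i j \<in> alg"
    "\<And>i j. i < n \<Longrightarrow> j < n \<Longrightarrow> X i j = (\<Sum>l<n. star (B l i) * B l j)"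
    unfolding positive_matrix_over_def by blast
  define m where "m = n * ?k"
  define z where "z l r = (if l < n \<and> r < m then B l (r div ?k) * W (xs ! (r mod ?k)) else 0)" for l r
  have idx: "r div ?k < n" "r mod ?k < ?k" if "r < m" for r
  proof -
    have "?k > 0" using that by (cases "?k = 0") (auto simp: m_def)
    then show "r div ?k < n" "r mod ?k < ?k"
      using that by (auto simp: m_def less_mult_imp_div_less)
  qed
  have z: "z l r \<in> alg" for l r using B(1) idx by (auto simp: z_def)
  obtain C where C: "\<And>r s. r < m \<Longrightarrow> s < m \<Longrightarrow>
      (\<Sum>l<n. l2_inner (z l r) (z l s)) = (\<Sum>l<m. cnj (C l r) * C l s)"
    using gram_factorization[of z m n, OF z] by blast
  define M where "M = mat m m (\<lambda>(l, r). C l r)"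
  have M: "M \<in> carrier_mat m m" by (simp add: M_def)
  have "amplification n ?k (compression xs) X = mat_adjoint M * M"
  proof (rule eq_matI)
    fix r s assume "r < dim_row (mat_adjoint M * M)" "s < dim_col (mat_adjoint M * M)"
    then have rs: "r < m" "s < m" by (simp_all add: M_def)
    have "amplification n ?k (compression xs) X $$ (r, s) =
        l2_inner (W (xs ! (r mod ?k))) (X (r div ?k) (s div ?k) * W (xs ! (s mod ?k)))"
      using rs idx by (simp add: amplification_def m_def[symmetric] compression_index)
    also have "\<dots> = (\<Sum>l<n. l2_inner (W (xs ! (r mod ?k)))
        (star (B l (r div ?k)) * (B l (s div ?k) * W (xs ! (s mod ?k)))))"
      unfolding B(2)[OF idx(1)[OF rs(1)] idx(1)[OF rs(2)]] sum_distrib_right mult.assoc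
      using B(1) idx rs by (intro l2_inner_right(4)) auto
    also have "\<dots> = (\<Sum>l<n. l2_inner (z l r) (z l s))"
      using rs by (intro sum.cong refl) (simp add: z_def l2_inner_mult_left)
    also have "\<dots> = (\<Sum>l<m. cnj (C l r) * C l s)" using rs by (rule C)
    also have "\<dots> = (mat_adjoint M * M) $$ (r, s)"
      using rs M by (simp add: scalar_prod_def index_mat_adjoint lessThan_atLeast0 M_def)
    finally show "amplification n ?k (compression xs) X $$ (r, s) = (mat_adjoint M * M) $$ (r, s)" .
  qed (simp_all add: amplification_def m_def M_def)
  moreover have "dim_row (amplification n ?k (compression xs) X) = m"
    by (simp add: amplification_def m_def)
  ultimately show "positive_complex_matrix (amplification n ?k (compression xs) X)"
    unfolding positive_complex_matrix_def using M by auto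
qed

lemma compression_ccp: "distinct xs \<Longrightarrow> ccp_map alg (length xs) (compression xs)"
  by (simp add: ccp_map_def compression_completely_positive compression_contractive)

subsection \<open>Asymptotic multiplicativity\<close>

text \<open>
  The component of \<open>z\<close> orthogonal to the span of the Weyl elements indexed by \<open>xs\<close>.
\<close>

definition escape :: "'x list \<Rightarrow> 'a \<Rightarrow> 'a" where
  "escape xs z = z - (\<Sum>i<length xs. l2_inner (W (xs ! i)) z *\<^sub>C W (xs ! i))"

text \<open>
  The normalized Hilbert-Schmidt norm of \<open>(1 - P) B P\<close>, for the projection \<open>P\<close> onto the span of the Weyl
  elements indexed by \<open>xs\<close>.
\<close>

definition leakage :: "'x list \<Rightarrow> 'a \<Rightarrow> real" where
  "leakage xs B = L2_set (\<lambda>j. l2_norm (escape xs (B * W (xs ! j)))) {..<length xs} / sqrt (length xs)"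

lemma escape_alg [simp]: "z \<in> alg \<Longrightarrow> escape xs z \<in> alg"
  by (auto simp: escape_def)

lemma escape_add: "z \<in> alg \<Longrightarrow> w \<in> alg \<Longrightarrow> escape xs (z + w) = escape xs z + escape xs w"
  by (simp add: escape_def l2_inner_right scaleC_add_left sum.distrib)

lemma escape_scale: "z \<in> alg \<Longrightarrow> escape xs (c *\<^sub>C z) = c *\<^sub>C escape xs z"
  by (simp add: escape_def l2_inner_right complex_vector.scale_right_diff_distrib
      complex_vector.scale_sum_right scaleC_scaleC)

lemma l2_norm_escape_le:
  assumes "distinct xs" "z \<in> alg"
  shows "l2_norm (escape xs z) \<le> l2_norm z"
proof -
  have "(l2_norm (escape xs z))\<^sup>2 \<le> (l2_norm z)\<^sup>2"
    unfolding escape_def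
    by (subst l2_pythagoras[OF assms(2) _ inj_on_nth_lessThan[OF assms(1)]]) (auto intro!: sum_nonneg)
  then show ?thesis using assms(2) by (auto intro: power2_le_imp_le simp: l2_norm_nonneg)
qed

text \<open>
  With the projection \<open>P\<close>, the defect is \<open>P A (1 - P) B P\<close>. As the right-hand side depends
  on \<open>B\<close> through a seminorm, its convergence to zero can be checked on Weyl elements.
\<close>

lemma compression_mult_defect:
  assumes xs: "distinct xs" and A: "A \<in> alg" and B: "B \<in> alg"
  shows "trace_norm2 (compression xs (A * B) - compression xs A * compression xs B)
    \<le> norm A * leakage xs B"
proof -
  let ?k = "length xs"
  let ?D = "compression xs (A * B) - compression xs A * compression xs B"
  let ?e = "\<lambda>j. escape xs (B * W (xs ! j))"
  have D: "?D $$ (i, j) = l2_inner (W (xs ! i)) (A * ?e j)" if "i < ?k" "j < ?k" for i j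
    using that A B
    by (simp add: compression_index scalar_prod_def escape_def right_diff_distrib sum_distrib_left
        mult_scaleC_right l2_inner_right lessThan_atLeast0 mult.assoc mult.commute[of _ "l2_inner _ (B * _)"])
  have "(\<Sum>j<?k. \<Sum>i<?k. (cmod (?D $$ (i, j)))\<^sup>2) = (\<Sum>j<?k. (projected_norm xs (A * ?e j))\<^sup>2)"
  proof (intro sum.cong refl)
    fix j assume "j \<in> {..<?k}"
    then have "(\<Sum>i<?k. (cmod (?D $$ (i, j)))\<^sup>2) =
        (\<Sum>i<?k. (cmod (l2_inner (W (xs ! i)) (A * ?e j)))\<^sup>2)"
      by (intro sum.cong refl) (simp only: D lessThan_iff)
    then show "(\<Sum>i<?k. (cmod (?D $$ (i, j)))\<^sup>2) = (projected_norm xs (A * ?e j))\<^sup>2"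
      by (simp add: projected_norm_def L2_set_def sum_nonneg)
  qed
  also have "\<dots> \<le> (\<Sum>j<?k. (norm A * l2_norm (?e j))\<^sup>2)"
    using A B xs
    by (intro sum_mono power_mono order_trans[OF projected_norm_le l2_norm_mult_le])
       (auto simp: projected_norm_nonneg)
  finally have "sqrt ((\<Sum>j<?k. \<Sum>i<?k. (cmod (?D $$ (i, j)))\<^sup>2) / real ?k) \<le>
      sqrt ((\<Sum>j<?k. (norm A * l2_norm (?e j))\<^sup>2) / real ?k)"
    by (intro real_sqrt_le_mono divide_right_mono) auto
  also have "\<dots> = norm A * leakage xs B"
    by (simp add: leakage_def L2_set_def real_sqrt_divide power_mult_distrib sum_distrib_left[symmetric]
        real_sqrt_mult)
  finally show ?thesis
    by (subst trace_norm2_eq[of _ ?k]) auto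
qed

lemma leakage_nonneg: "0 \<le> leakage xs B"
  by (simp add: leakage_def L2_set_nonneg)

lemma leakage_add:
  assumes "A \<in> alg" "B \<in> alg"
  shows "leakage xs (A + B) \<le> leakage xs A + leakage xs B"
proof -
  have "L2_set (\<lambda>j. l2_norm (escape xs ((A + B) * W (xs ! j)))) {..<length xs} \<le>
     L2_set (\<lambda>j. l2_norm (escape xs (A * W (xs ! j))) + l2_norm (escape xs (B * W (xs ! j)))) {..<length xs}"
    using assms by (intro L2_set_mono) (auto simp: distrib_right escape_add l2_norm_triangle l2_norm_nonneg)
  also note L2_set_triangle_ineq
  finally show ?thesis
    unfolding leakage_def add_divide_distrib[symmetric] by (rule divide_right_mono) simp
qed

lemma leakage_scale: "B \<in> alg \<Longrightarrow> leakage xs (c *\<^sub>C B) = cmod c * leakage xs B"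
  by (simp add: leakage_def mult_scaleC_left escape_scale l2_norm_scale L2_set_right_distrib[symmetric])

lemma leakage_le_norm:
  assumes xs: "distinct xs" "xs \<noteq> []" and B: "B \<in> alg"
  shows "leakage xs B \<le> norm B"
proof -
  have "l2_norm (escape xs (B * W (xs ! j))) \<le> norm B" for j
    using l2_norm_escape_le[OF xs(1), of "B * W (xs ! j)"] l2_norm_mult_le[OF B, of "W (xs ! j)"] B
    by simp
  then have "L2_set (\<lambda>j. l2_norm (escape xs (B * W (xs ! j)))) {..<length xs} \<le>
      L2_set (\<lambda>j. norm B) {..<length xs}"
    using B by (intro L2_set_mono) (auto simp: l2_norm_nonneg)
  also have "\<dots> = norm B * sqrt (length xs)"
    by (simp add: L2_set_def real_sqrt_mult mult.commute)
  finally show ?thesis using xs by (simp add: leakage_def pos_divide_le_eq)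
qed

text \<open>
  The translation by \<open>b\<close> leaves a basis vector \<open>W g\<close> in the span, unless \<open>b + g\<close> is outside \<open>xs\<close>.
\<close>

lemma leakage_W_le:
  assumes xs: "distinct xs" "xs \<noteq> []"
  shows "leakage xs (W b) \<le> sqrt (boundary_ratio b xs)"
proof -
  have e: "(l2_norm (escape xs (W b * W (xs ! j))))\<^sup>2 \<le> of_bool (b + xs ! j \<notin> set xs)" for j
  proof (cases "b + xs ! j \<in> set xs")
    case True
    then obtain m where m: "m < length xs" "b + xs ! j = xs ! m" by (metis in_set_conv_nth)
    have "(\<Sum>i<length xs. l2_inner (W (xs ! i)) (W (xs ! m)) *\<^sub>C W (xs ! i)) =
        (\<Sum>i<length xs. if i = m then W (xs ! m) else 0)"
      using xs(1) m(1)
      by (intro sum.cong refl) (auto simp: l2_inner_W nth_eq_iff_index_eq scaleC_one)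
    then have "escape xs (W (xs ! m)) = 0" using m(1) by (simp add: escape_def)
    then show ?thesis
      by (simp add: W_mult m(2) escape_scale l2_norm_def l2_inner_def)
  next
    case False
    have "l2_norm (escape xs (W b * W (xs ! j))) \<le> 1"
      using l2_norm_escape_le[OF xs(1), of "W b * W (xs ! j)"] by (simp add: W_mult l2_norm_scale)
    then have "(l2_norm (escape xs (W b * W (xs ! j))))\<^sup>2 \<le> 1\<^sup>2"
      by (intro power_mono) (auto simp: l2_norm_nonneg)
    then show ?thesis using False by simp
  qed
  have "(\<Sum>j<length xs. (l2_norm (escape xs (W b * W (xs ! j))))\<^sup>2) \<le>
      (\<Sum>j<length xs. of_bool (b + xs ! j \<notin> set xs))"
    by (intro sum_mono e)
  also have "\<dots> = (\<Sum>g\<in>set xs. of_bool (b + g \<notin> set xs))"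
    by (rule sum.reindex_bij_betw[OF bij_betw_nth[OF xs(1) refl refl],
          of "\<lambda>g. of_bool (b + g \<notin> set xs)"])
  also have "\<dots> = real (card {g \<in> set xs. b + g \<notin> set xs})"
    by (simp add: Int_def)
  finally show ?thesis
    unfolding leakage_def L2_set_def boundary_ratio_def real_sqrt_divide[symmetric]
    by (intro real_sqrt_le_mono divide_right_mono) auto
qed

text \<open>
  The elements with vanishing leakage form a closed subspace, because leakage is a seminorm dominated
  by the norm uniformly in \<open>xs\<close>; by the F{\o}lner property it contains the Weyl elements.
\<close>

lemma leakage_tendsto_zero:
  assumes L: "foelner_filter L" and B: "B \<in> alg"
  shows "((\<lambda>xs. leakage xs B) \<longlongrightarrow> 0) L"
proof -
  have ev: "\<forall>\<^sub>F xs in L. distinct xs \<and> xs \<noteq> []"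
    and bd: "(boundary_ratio b \<longlongrightarrow> 0) L" for b
    using L by (auto simp: foelner_filter_def)
  have W: "((\<lambda>xs. leakage xs (W b)) \<longlongrightarrow> 0) L" for b
  proof (rule tendsto_sandwich[OF _ _ tendsto_const])
    show "((\<lambda>xs. sqrt (boundary_ratio b xs)) \<longlongrightarrow> 0) L"
      using tendsto_real_sqrt[OF bd[of b]] by simp
    show "\<forall>\<^sub>F xs in L. leakage xs (W b) \<le> sqrt (boundary_ratio b xs)"
      using ev by (rule eventually_mono) (simp add: leakage_W_le)
  qed (simp add: leakage_nonneg)
  have trig: "y \<in> alg \<and> ((\<lambda>xs. leakage xs y) \<longlongrightarrow> 0) L" if "y \<in> trig" for y
    using that
  proof (induction y rule: complex_vector.span_induct_alt)
    case base
    have "leakage xs 0 = 0" for xs using leakage_scale[of 0 xs 0] by simp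
    then show ?case by simp
  next
    case (step c v z)
    then obtain b where v: "v = W b" by auto
    have le: "leakage xs (c *\<^sub>C W b + z) \<le> cmod c * leakage xs (W b) + leakage xs z" for xs
      using leakage_add[of "c *\<^sub>C W b" z xs] step by (simp add: leakage_scale)
    have "((\<lambda>xs. cmod c * leakage xs (W b) + leakage xs z) \<longlongrightarrow> 0) L"
      using tendsto_add[OF tendsto_mult_left[OF W[of b], of "cmod c"], of "\<lambda>xs. leakage xs z" 0] step
      by simp
    then have "((\<lambda>xs. leakage xs (c *\<^sub>C W b + z)) \<longlongrightarrow> 0) L"
      by (rule tendsto_sandwich[OF _ _ tendsto_const, rotated 2])
         (intro always_eventually allI leakage_nonneg le)+
    then show ?case using step v by simp
  qed
  show ?thesis
  proof (rule tendstoI)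
    fix e :: real assume e: "0 < e"
    obtain y where y: "y \<in> trig" "dist y B < e / 2"
      using B e unfolding closure_approachable by (meson half_gt_zero)
    have "\<forall>\<^sub>F xs in L. dist (leakage xs y) 0 < e / 2"
      using trig[OF y(1)] e by (intro tendstoD) auto
    with ev show "\<forall>\<^sub>F xs in L. dist (leakage xs B) 0 < e"
    proof eventually_elim
      case (elim xs)
      have "leakage xs B \<le> leakage xs y + leakage xs (B - y)"
        using leakage_add[of y "B - y" xs] B trig_alg[OF y(1)] by simp
      also have "leakage xs (B - y) \<le> norm (B - y)"
        using elim B trig_alg[OF y(1)] by (intro leakage_le_norm) auto
      finally show ?case
        using elim y(2) leakage_nonneg[of xs] by (simp add: dist_norm norm_minus_commute)
    qed
  qed
qed

subsection \<open>Asymptotic isometry\<close>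

lemma span_W_power:
  assumes T: "finite T" and h: "h \<in> cspan (W ` T)"
  shows "h ^ n \<in> cspan (W ` semigroup_box T n)"
proof (induction n)
  case 0
  then show ?case using W_in_span[OF zero_in_box[of T 0]] by simp
next
  case (Suc n)
  show ?case unfolding power_Suc
    by (rule span_W_mult[OF h Suc.IH]) (rule box_add[OF T])
qed

lemma norm_le_l2_norm:
  assumes S: "finite S" "x \<in> cspan (W ` S)"
  shows "norm x \<le> sqrt (card S) * l2_norm x"
proof -
  obtain c where c: "x = (\<Sum>f\<in>S. c f *\<^sub>C W f)" using span_W_finite[OF S] .
  have "norm x \<le> (\<Sum>f\<in>S. \<bar>1\<bar> * \<bar>cmod (c f)\<bar>)"
    unfolding c by (rule order_trans[OF norm_sum]) (simp add: norm_scaleC)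
  also have "\<dots> \<le> L2_set (\<lambda>f. 1) S * L2_set (\<lambda>f. cmod (c f)) S" by (rule L2_set_mult_ineq)
  also have "L2_set (\<lambda>f. 1 :: real) S = sqrt (card S)" by (simp add: L2_set_def)
  also have "L2_set (\<lambda>f. cmod (c f)) S = l2_norm x"
    unfolding c by (rule l2_norm_trig_sum[OF S(1) inj_on_id2, symmetric])
  finally show ?thesis .
qed

text \<open>
  The action on the pre-Hilbert space of the trace determines the norm. With \<open>h = star a * a\<close>, the power
  \<open>h ^ n\<close> is supported on a box with polynomially many points, so that its norm exceeds its \<open>l2_norm\<close>,
  which is at most \<open>r ^ (2 * n)\<close>, by a polynomial factor only. As \<open>norm (h ^ n) = norm a ^ (2 * n)\<close> for
  \<open>n = 2 ^ k\<close>, the polynomial factor disappears in the limit.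
\<close>

lemma norm_le_l2_bound:
  assumes a: "a \<in> trig" and r: "0 < r"
    and bound: "\<And>y. y \<in> trig \<Longrightarrow> l2_norm (a * y) \<le> r * l2_norm y"
  shows "norm a \<le> r"
proof -
  have bound_star: "l2_norm (star a * y) \<le> r * l2_norm y" if y: "y \<in> trig" for y
  proof -
    define u where "u = star a * y"
    have u: "u \<in> trig" unfolding u_def by (intro trig_mult trig_star a y)
    note alg = trig_alg[OF a] trig_alg[OF y] trig_alg[OF u]
    have "complex_of_real ((l2_norm u)\<^sup>2) = l2_inner y (a * u)"
      using alg by (simp add: l2_norm_square' u_def l2_inner_mult_left star_star)
    then have "(l2_norm u)\<^sup>2 = cmod (l2_inner y (a * u))"
      by (metis abs_power2 norm_of_real)
    also have "\<dots> \<le> l2_norm y * l2_norm (a * u)" using alg by (intro l2_cauchy_schwarz) auto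
    also have "\<dots> \<le> l2_norm y * (r * l2_norm u)"
      using alg by (intro mult_left_mono bound u) (simp add: l2_norm_nonneg)
    finally have "l2_norm u * l2_norm u \<le> (r * l2_norm y) * l2_norm u"
      by (simp add: power2_eq_square ac_simps)
    then show ?thesis
      using l2_norm_nonneg[OF alg(2)] l2_norm_nonneg[OF alg(3)] r
      by (cases "l2_norm u = 0") (auto simp flip: u_def)
  qed
  define h where "h = star a * a"
  have h: "h \<in> trig" unfolding h_def by (intro trig_mult trig_star a)
  then obtain T where T: "finite T" "h \<in> cspan (W ` T)" by (rule trig_finite_support)
  have hn: "h ^ n \<in> trig \<and> l2_norm (h ^ n) \<le> (r\<^sup>2) ^ n" for n
  proof (induction n)
    case 0
    show ?case using l2_norm_W[of 0] by simp
  next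
    case (Suc n)
    have "l2_norm (h ^ Suc n) = l2_norm (star a * (a * h ^ n))" by (simp add: h_def mult.assoc)
    also have "\<dots> \<le> r * l2_norm (a * h ^ n)" using Suc a by (intro bound_star trig_mult) auto
    also have "\<dots> \<le> r * (r * l2_norm (h ^ n))" using Suc r by (intro mult_left_mono bound) auto
    also have "\<dots> \<le> r * (r * (r\<^sup>2) ^ n)" using Suc r by (intro mult_left_mono) auto
    finally show ?case using Suc h by (simp add: trig_mult power2_eq_square ac_simps)
  qed
  have "(norm h / r\<^sup>2) ^ (2 ^ k) \<le> 1 * (real (2 ^ k) + 1) ^ card T" for k
  proof -
    let ?n = "2 ^ k :: nat"
    have "norm h ^ ?n = norm (h ^ ?n)"
      by (rule norm_power_selfadjoint[symmetric]) (simp add: h_def star_mult star_star)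
    also have "\<dots> \<le> sqrt (card (semigroup_box T ?n)) * l2_norm (h ^ ?n)"
      using T by (intro norm_le_l2_norm finite_box span_W_power)
    also have "\<dots> \<le> (real ?n + 1) ^ card T * (r\<^sup>2) ^ ?n"
    proof (intro mult_mono)
      have "real (card (semigroup_box T ?n)) \<le> (real ?n + 1) ^ card T"
        using of_nat_mono[OF card_box_le[OF T(1), of ?n], where 'a = real] by (simp add: add.commute)
      also have "\<dots> \<le> ((real ?n + 1) ^ card T)\<^sup>2" by (rule self_le_power) auto
      finally show "sqrt (card (semigroup_box T ?n)) \<le> (real ?n + 1) ^ card T" by (intro real_le_lsqrt) auto
      show "l2_norm (h ^ ?n) \<le> (r\<^sup>2) ^ ?n" using hn by blast
      show "0 \<le> l2_norm (h ^ ?n)" using hn by (intro l2_norm_nonneg trig_alg) blast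
    qed simp
    finally show ?thesis
      using r by (simp add: power_divide pos_divide_le_eq)
  qed
  then have "norm h / r\<^sup>2 \<le> 1" by (rule le_one_of_dyadic_power_bound)
  then have "(norm a)\<^sup>2 \<le> r\<^sup>2" using r by (simp add: h_def cstar_identity)
  then show ?thesis using r by (auto intro: power2_le_imp_le)
qed

text \<open>
  An approximating trigonometric polynomial \<open>a\<close> has a test vector \<open>y\<close> that it stretches by almost
  \<open>norm A\<close>. Both \<open>y\<close> and \<open>a * y\<close> have finite support, and any compression to a larger set sees them
  unchanged.
\<close>

lemma compression_norm_lower_bound:
  assumes A: "A \<in> alg" and r: "0 < r" "r < norm A"
  obtains T where "finite T"
    "\<And>xs. distinct xs \<Longrightarrow> T \<subseteq> set xs \<Longrightarrow> r < operator_norm (compression xs A)"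
proof -
  \<comment> \<open>half of the gap pays for replacing \<open>A\<close> by \<open>a\<close> in the norm, half for doing so in the action\<close>
  define e where "e = (norm A - r) / 2"
  have e: "0 < e" using r by (simp add: e_def)
  then obtain a where a: "a \<in> trig" "dist a A < e" using A unfolding closure_approachable by blast
  have aA: "norm (A - a) < e" using a(2) by (simp add: dist_norm norm_minus_commute)
  have "norm A \<le> norm a + norm (A - a)" using norm_triangle_ineq[of a "A - a"] by simp
  then have "r + e < norm a" using aA by (simp add: e_def field_simps)
  then obtain y where y: "y \<in> trig" "(r + e) * l2_norm y < l2_norm (a * y)"
    using norm_le_l2_bound[OF a(1), of "r + e"] r(1) e by (meson add_pos_pos not_le)
  obtain S where S: "finite S" "y \<in> cspan (W ` S)" using y(1) by (rule trig_finite_support)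
  obtain S' where S': "finite S'" "a * y \<in> cspan (W ` S')"
    using trig_mult[OF a(1) y(1)] by (rule trig_finite_support)
  note alg = A trig_alg[OF a(1)] trig_alg[OF y(1)]
  show thesis
  proof (rule that[of "S \<union> S'"])
    show "finite (S \<union> S')" using S S' by simp
    fix xs assume xs: "distinct xs" "S \<union> S' \<subseteq> set xs"
    define v where "v = vec (length xs) (\<lambda>i. l2_inner (W (xs ! i)) y)"
    have v: "v \<in> carrier_vec (length xs)" by (simp add: v_def)
    have yv: "synthesis xs v = y"
      unfolding v_def using xs S by (intro span_W_coordinates[symmetric]) (auto intro: span_W_mono)
    have nv: "euclidean_norm v = l2_norm y" using l2_norm_synthesis[OF xs(1) v] yv by simp
    have ay: "projected_norm xs (a * y) = l2_norm (a * y)"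
      using xs S' by (intro projected_norm_span) (auto intro: span_W_mono)
    have "a * y = A * y + (a - A) * y" by (simp add: algebra_simps)
    then have tri: "projected_norm xs (a * y) \<le> projected_norm xs (A * y) + projected_norm xs ((a - A) * y)"
      using projected_norm_triangle[of "A * y" "(a - A) * y" xs] alg by simp
    have "projected_norm xs ((a - A) * y) \<le> l2_norm ((a - A) * y)"
      using alg xs by (intro projected_norm_le) auto
    also have "\<dots> \<le> norm (a - A) * l2_norm y"
      using alg by (intro l2_norm_mult_le) auto
    also have "\<dots> \<le> e * l2_norm y"
      using aA alg by (intro mult_right_mono) (auto simp: norm_minus_commute l2_norm_nonneg)
    finally have "l2_norm (a * y) \<le> projected_norm xs (A * y) + e * l2_norm y"
      using tri unfolding ay by linarith
    then have "r * l2_norm y < projected_norm xs (A * y)"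
      using y(2) unfolding distrib_right by linarith
    also have "\<dots> = euclidean_norm (compression xs A *\<^sub>v v)"
      using compression_apply[OF A v] yv by simp
    also have "\<dots> \<le> operator_norm (compression xs A) * l2_norm y"
      using le_operator_norm[OF compression_carrier compression_bound[OF xs(1) A] _ v] nv by simp
    finally show "r < operator_norm (compression xs A)"
      using l2_norm_nonneg[OF alg(3)] by (simp add: mult_less_cancel_right)
  qed
qed

theorem folner_weyl: "folner_cstar_algebra alg"
proof -
  obtain L :: "'x list filter" where L: "foelner_filter L"
    using foelner_filter_exists ..
  then have L': "L \<noteq> bot" "\<forall>\<^sub>F xs in L. distinct xs \<and> xs \<noteq> []"
      "\<And>T. finite T \<Longrightarrow> \<forall>\<^sub>F xs in L. T \<subseteq> set xs"
    by (simp_all add: foelner_filter_def)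
  show ?thesis
    unfolding folner_cstar_algebra_def
  proof (intro conjI exI[of _ "filtermap compression L"] ballI)
    show "cstar_subalgebra alg" by (rule cstar_subalgebra_alg)
    show "filtermap compression L \<noteq> bot" using L' by (simp add: filtermap_bot_iff)
    show "\<forall>\<^sub>F \<phi> in filtermap compression L. \<exists>k>0. ccp_map alg k \<phi>"
      unfolding eventually_filtermap using L'(2)
      by (rule eventually_mono) (auto intro!: exI[of _ "length _"] compression_ccp)
  next
    fix A B assume A: "A \<in> alg" and B: "B \<in> alg"
    have "((\<lambda>xs. norm A * leakage xs B) \<longlongrightarrow> 0) L"
      using tendsto_mult_left[OF leakage_tendsto_zero[OF L B], of "norm A"] by simp
    then have "((\<lambda>xs. trace_norm2 (compression xs (A * B) - compression xs A * compression xs B)) \<longlongrightarrow> 0) L"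
    proof (rule tendsto_sandwich[OF _ _ tendsto_const, rotated 2])
      show "\<forall>\<^sub>F xs in L. 0 \<le> trace_norm2 (compression xs (A * B) - compression xs A * compression xs B)"
      proof (rule always_eventually, rule allI)
        fix xs
        show "0 \<le> trace_norm2 (compression xs (A * B) - compression xs A * compression xs B)"
          by (subst trace_norm2_eq[of _ "length xs"]) (auto intro!: sum_nonneg divide_nonneg_nonneg)
      qed
      show "\<forall>\<^sub>F xs in L. trace_norm2 (compression xs (A * B) - compression xs A * compression xs B)
          \<le> norm A * leakage xs B"
        using L'(2) by (rule eventually_mono) (use A B in \<open>simp add: compression_mult_defect\<close>)
    qed
    then show "((\<lambda>\<phi>. trace_norm2 (\<phi> (A * B) - \<phi> A * \<phi> B)) \<longlongrightarrow> 0) (filtermap compression L)"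
      by (simp add: filterlim_filtermap)
  next
    fix A assume A: "A \<in> alg"
    have "((\<lambda>xs. operator_norm (compression xs A)) \<longlongrightarrow> norm A) L"
    proof (rule order_tendstoI)
      fix b assume b: "norm A < b"
      show "\<forall>\<^sub>F xs in L. operator_norm (compression xs A) < b"
        using L'(2) by (rule eventually_mono) (use A b in \<open>blast intro: le_less_trans compression_contractive\<close>)
    next
      fix r :: real assume r: "r < norm A"
      show "\<forall>\<^sub>F xs in L. r < operator_norm (compression xs A)"
      proof (cases "0 \<le> r")
        case True
        \<comment> \<open>the lower bound needs a strictly positive constant\<close>
        define r' where "r' = (r + norm A) / 2"
        have "0 < r'" "r' < norm A" "r \<le> r'" using True r by (auto simp: r'_def)
        then obtain T where T: "finite T"
          "\<And>xs. distinct xs \<Longrightarrow> T \<subseteq> set xs \<Longrightarrow> r' < operator_norm (compression xs A)"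
          using compression_norm_lower_bound[OF A] by blast
        show ?thesis using L'(2) L'(3)[OF T(1)]
          by eventually_elim (use T(2) \<open>r \<le> r'\<close> in \<open>auto intro: le_less_trans\<close>)
      next
        case False
        show ?thesis using L'(2)
        proof (rule eventually_mono)
          fix xs :: "'x list" assume "distinct xs \<and> xs \<noteq> []"
          then have xs: "distinct xs" "xs \<noteq> []" by auto
          define v :: "complex vec" where "v = vec (length xs) (\<lambda>i. 1)"
          have v: "v \<in> carrier_vec (length xs)" by (simp add: v_def)
          have "0 < euclidean_norm v" using xs by (simp add: v_def euclidean_norm_def L2_set_def)
          moreover have "0 \<le> operator_norm (compression xs A) * euclidean_norm v"
            using le_operator_norm[OF compression_carrier compression_bound[OF xs(1) A] _ v]
              euclidean_norm_nonneg[of "compression xs A *\<^sub>v v"] by simp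
          ultimately have "0 \<le> operator_norm (compression xs A)" by (simp add: zero_le_mult_iff)
          then show "r < operator_norm (compression xs A)" using False by linarith
        qed
      qed
    qed
    then show "((\<lambda>\<phi>. operator_norm (\<phi> A)) \<longlongrightarrow> norm A) (filtermap compression L)"
      by (simp add: filterlim_filtermap)
  qed
qed

end

theorem theorem3p1:
  fixes \<sigma> :: "'x::real_vector \<Rightarrow> 'x \<Rightarrow> real"
    and W :: "'x \<Rightarrow> 'a::cstar_algebra"
  assumes "symplectic_form \<sigma>"
    and "weyl_elements \<sigma> W"
  shows "algebraically_amenable (weyl_star_algebra W) \<and> folner_cstar_algebra (weyl_algebra W)"
proof -
  interpret weyl_system \<sigma> W by unfold_locales (rule assms)+
  show ?thesis
    using algebraically_amenable_trig folner_weyl by (simp add: weyl_star_algebra_eq weyl_algebra_eq)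
qed

end
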